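(* Let $c_0>0$ be a sufficiently large constant and $\delta>0$, and suppose $c_0/n<p\leq n^{-5/6-\delta}$. Then each of $\bar\vartheta_{1/2}(G(n,p))$, $\bar\vartheta(G(n,p))$, $\bar\vartheta_2(G(n,p))$ is concentrated in width $1$: for each $X\in\{\bar\vartheta_{1/2},\bar\vartheta,\bar\vartheta_2\}$ there is a number $u=u_X(n,p)$ such that $\Pr(u\leq X(G(n,p))\leq u+1)=1-o(1)$ as $n\to\infty$.
   Context: $G(n,p)$ is the random graph on $V=\{1,\dots,n\}$ with each possible edge present independently with probability $p$. For a graph $G=(V,E)$ and a real $k>1$, an $n$-tuple $(v_1,\dots,v_n)$ of unit vectors in $\mathbb R^n$ is a vector $k$-coloring if $\langle v_i,v_j\rangle\leq-1/(k-1)$ for all $\{i,j\}\in E$; strict if $\langle v_i,v_j\rangle=-1/(k-1)$ for all $\{i,j\}\in E$; rigid if equality holds on all edges and $\langle v_i,v_j\rangle\geq-1/(k-1)$ for all non-adjacent $i\neq j$. $\bar\vartheta_{1/2}(G)$ (the vector chromatic number), $\bar\vartheta(G)$, $\bar\vartheta_2(G)$ denote the infimum of $k>1$ such that $G$ admits a vector, strict vector, resp. rigid vector $k$-coloring. *)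

theory Defs
  imports "HOL-Analysis.Analysis"
begin

text \<open>Graphs on the vertex set V = {1..n}: a set E of 2-element subsets of V.
  Vectors in R^n are functions nat => real, only coordinates 1..n matter.\<close>

definition all_pairs :: "nat \<Rightarrow> nat set set" where
  "all_pairs n = {{i, j} | i j. i \<in> {1..n} \<and> j \<in> {1..n} \<and> i \<noteq> j}"

definition gnp_prob :: "nat \<Rightarrow> real \<Rightarrow> (nat set set \<Rightarrow> bool) \<Rightarrow> real" where
  "gnp_prob n p P = (\<Sum>E \<in> Pow (all_pairs n).
      if P E then p ^ card E * (1 - p) ^ (card (all_pairs n) - card E) else 0)"

definition inner_n :: "nat \<Rightarrow> (nat \<Rightarrow> real) \<Rightarrow> (nat \<Rightarrow> real) \<Rightarrow> real" where
  "inner_n n x y = (\<Sum>l \<in> {1..n}. x l * y l)"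

definition unit_tuple :: "nat \<Rightarrow> (nat \<Rightarrow> nat \<Rightarrow> real) \<Rightarrow> bool" where
  "unit_tuple n v \<longleftrightarrow> (\<forall>i \<in> {1..n}. inner_n n (v i) (v i) = 1)"

definition vector_coloring :: "nat \<Rightarrow> nat set set \<Rightarrow> real \<Rightarrow> (nat \<Rightarrow> nat \<Rightarrow> real) \<Rightarrow> bool" where
  "vector_coloring n E k v \<longleftrightarrow> unit_tuple n v \<and>
     (\<forall>i \<in> {1..n}. \<forall>j \<in> {1..n}. {i, j} \<in> E \<longrightarrow> inner_n n (v i) (v j) \<le> -1 / (k - 1))"

definition strict_vector_coloring :: "nat \<Rightarrow> nat set set \<Rightarrow> real \<Rightarrow> (nat \<Rightarrow> nat \<Rightarrow> real) \<Rightarrow> bool" where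
  "strict_vector_coloring n E k v \<longleftrightarrow> unit_tuple n v \<and>
     (\<forall>i \<in> {1..n}. \<forall>j \<in> {1..n}. {i, j} \<in> E \<longrightarrow> inner_n n (v i) (v j) = -1 / (k - 1))"

definition rigid_vector_coloring :: "nat \<Rightarrow> nat set set \<Rightarrow> real \<Rightarrow> (nat \<Rightarrow> nat \<Rightarrow> real) \<Rightarrow> bool" where
  "rigid_vector_coloring n E k v \<longleftrightarrow> unit_tuple n v \<and>
     (\<forall>i \<in> {1..n}. \<forall>j \<in> {1..n}. {i, j} \<in> E \<longrightarrow> inner_n n (v i) (v j) = -1 / (k - 1)) \<and>
     (\<forall>i \<in> {1..n}. \<forall>j \<in> {1..n}. i \<noteq> j \<and> {i, j} \<notin> E \<longrightarrow> inner_n n (v i) (v j) \<ge> -1 / (k - 1))"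

definition theta_half :: "nat \<Rightarrow> nat set set \<Rightarrow> real" where
  "theta_half n E = Inf {k. k > 1 \<and> (\<exists>v. vector_coloring n E k v)}"

definition theta :: "nat \<Rightarrow> nat set set \<Rightarrow> real" where
  "theta n E = Inf {k. k > 1 \<and> (\<exists>v. strict_vector_coloring n E k v)}"

definition theta_2 :: "nat \<Rightarrow> nat set set \<Rightarrow> real" where
  "theta_2 n E = Inf {k. k > 1 \<and> (\<exists>v. rigid_vector_coloring n E k v)}"

definition conc_width1 :: "real \<Rightarrow> real \<Rightarrow> (nat \<Rightarrow> nat set set \<Rightarrow> real) \<Rightarrow> bool" where
  "conc_width1 c0 \<delta> X \<longleftrightarrow> (\<forall>p :: nat \<Rightarrow> real.
     (\<forall>\<^sub>F n in sequentially. c0 / real n < p n \<and> p n \<le> real n powr (-5/6 - \<delta>)) \<longrightarrow>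
     (\<exists>u :: nat \<Rightarrow> real.
        (\<lambda>n. gnp_prob n (p n) (\<lambda>E. u n \<le> X n E \<and> X n E \<le> u n + 1)) \<longlonglongrightarrow> 1))"

end

theory Submission
  imports Defs
begin

text \<open>
  Let \<open>u\<close> be the least value with \<open>Pr (X \<le> u) \<ge> \<epsilon>\<close>. The least number \<open>Y\<close> of vertices whose deletion
  brings \<open>X\<close> down to \<open>u\<close> changes by at most 1 when the edges at one vertex change, so its variance is at
  most \<open>n\<close>. As \<open>Y = 0\<close> has probability at least \<open>\<epsilon>\<close>, Chebyshev gives \<open>Y < 2 sqrt (n / \<epsilon>)\<close> outside
  an event of probability \<open>\<epsilon>\<close> (Shamir and Spencer). With \<open>\<epsilon>\<close> a small negative power of \<open>n\<close> and
  \<open>p \<le> n powr (-5/6 - \<delta>)\<close>, sets of this size span fewer than \<open>(3/2 - \<delta>)\<close> edges per vertex.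
  Hence (Luczak) the deleted set extends to a set \<open>W\<close> that is 3-colourable and
  whose outer boundary \<open>I\<close> is independent. Since no edge joins \<open>W\<close> to the rest, \<open>W\<close> costs no
  additional colour if \<open>u \<ge> 3\<close>, and \<open>I\<close> costs one.

  That \<open>u \<ge> 3\<close> holds because rounding a vector 4-colouring to signs yields a cut with a fixed positive
  proportion of surplus edges, which a random graph of large average degree lacks.
\<close>

section \<open>Positive semidefinite Gram matrices and vector colourings\<close>

text \<open>The exponent 5/6 is a break-even point. The set to be repaired has about
  \<open>sqrt n\<close> vertices, and each enlargement adds two vertices and three edges, so local
  density below 3/2 is what stops it. For sets of size up to \<open>T\<close> the first moment is
  governed by \<open>n * T powr (1/2) * p powr (3/2)\<close>; with \<open>T\<close> near
  \<open>sqrt n\<close> this is small when \<open>p\<close> is well below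
  \<open>n powr (-5/6)\<close>. The slack \<open>\<delta>\<close> pays for \<open>\<epsilon>\<close>
  and for the \<open>d\<close> in \<open>3/2 - d\<close>.

  The vectors must live in exactly \<open>n\<close> dimensions, which would obstruct gluing
  colourings and adding a new direction. Colourings are therefore handled as positive semidefinite
  matrices, and a factorisation returns to \<open>n\<close> coordinates at the end. Attainment of
  the infimum, a compactness matter, is avoided by reading \<open>X \<le> u\<close> as colourability
  for every \<open>k > u\<close>.

  The lower bound on \<open>p\<close> forces \<open>u \<ge> 3\<close>; without it the 3-coloured set
  could not share the colours of the rest.\<close>

definition psd_on :: "'a set \<Rightarrow> ('a \<Rightarrow> 'a \<Rightarrow> real) \<Rightarrow> bool" where
  "psd_on S M \<longleftrightarrow> (\<forall>i\<in>S. \<forall>j\<in>S. M i j = M j i) \<and>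
     (\<forall>c. 0 \<le> (\<Sum>i\<in>S. \<Sum>j\<in>S. c i * c j * M i j))"

lemma psd_onI:
  assumes "\<And>i j. i \<in> S \<Longrightarrow> j \<in> S \<Longrightarrow> M i j = M j i"
    and "\<And>c. 0 \<le> (\<Sum>i\<in>S. \<Sum>j\<in>S. c i * c j * M i j)"
  shows "psd_on S M"
  using assms by (auto simp: psd_on_def)

lemma psd_on_sym: "psd_on S M \<Longrightarrow> i \<in> S \<Longrightarrow> j \<in> S \<Longrightarrow> M i j = M j i"
  by (auto simp: psd_on_def)

lemma psd_on_nonneg: "psd_on S M \<Longrightarrow> 0 \<le> (\<Sum>i\<in>S. \<Sum>j\<in>S. c i * c j * M i j)"
  by (auto simp: psd_on_def)

lemma psd_on_add:
  assumes "psd_on S M" "psd_on S N"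
  shows "psd_on S (\<lambda>i j. M i j + N i j)"
proof (rule psd_onI)
  show "M i j + N i j = M j i + N j i" if "i \<in> S" "j \<in> S" for i j
    using assms that by (metis psd_on_sym)
  show "0 \<le> (\<Sum>i\<in>S. \<Sum>j\<in>S. c i * c j * (M i j + N i j))" for c
    using psd_on_nonneg[OF assms(1), of c] psd_on_nonneg[OF assms(2), of c]
    by (simp add: distrib_left sum.distrib)
qed

lemma psd_on_scale:
  assumes "psd_on S M" "0 \<le> a"
  shows "psd_on S (\<lambda>i j. a * M i j)"
proof (rule psd_onI)
  show "a * M i j = a * M j i" if "i \<in> S" "j \<in> S" for i j
    using assms that by (metis psd_on_sym)
  have "(\<Sum>i\<in>S. \<Sum>j\<in>S. c i * c j * (a * M i j)) = a * (\<Sum>i\<in>S. \<Sum>j\<in>S. c i * c j * M i j)" for c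
    by (simp add: sum_distrib_left mult_ac)
  then show "0 \<le> (\<Sum>i\<in>S. \<Sum>j\<in>S. c i * c j * (a * M i j))" for c
    using psd_on_nonneg[OF assms(1), of c] assms(2) by simp
qed

lemma psd_on_rank_one: "psd_on S (\<lambda>i j. u i * u j)"
proof (rule psd_onI)
  fix c :: "'a \<Rightarrow> real"
  have "(\<Sum>i\<in>S. \<Sum>j\<in>S. c i * c j * (u i * u j)) = (\<Sum>i\<in>S. c i * u i)\<^sup>2"
    by (simp add: power2_eq_square sum_product mult_ac)
  then show "0 \<le> (\<Sum>i\<in>S. \<Sum>j\<in>S. c i * c j * (u i * u j))" by simp
qed (simp add: mult.commute)

lemma psd_on_sum:
  assumes "\<And>l. l \<in> L \<Longrightarrow> psd_on S (M l)"
  shows "psd_on S (\<lambda>i j. \<Sum>l\<in>L. M l i j)"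
proof (cases "finite L")
  case True
  then show ?thesis using assms
  proof (induction L)
    case empty
    show ?case by (simp add: psd_on_def)
  next
    case (insert l L)
    then show ?case by (simp add: psd_on_add)
  qed
qed (simp add: psd_on_def)

lemma psd_on_gram: "psd_on S (\<lambda>i j. \<Sum>l\<in>L. v i l * v j l)"
  by (rule psd_on_sum) (rule psd_on_rank_one)

lemma psd_on_subset:
  assumes "psd_on S M" "T \<subseteq> S" "finite S"
  shows "psd_on T M"
proof (rule psd_onI)
  show "M i j = M j i" if "i \<in> T" "j \<in> T" for i j
    using assms that by (auto intro: psd_on_sym)
  fix c :: "'a \<Rightarrow> real"
  define c' where "c' i = (if i \<in> T then c i else 0)" for i
  have "(\<Sum>i\<in>S. \<Sum>j\<in>S. c' i * c' j * M i j) = (\<Sum>i\<in>T. \<Sum>j\<in>S. c' i * c' j * M i j)"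
    using assms by (intro sum.mono_neutral_right) (auto simp: c'_def)
  also have "\<dots> = (\<Sum>i\<in>T. \<Sum>j\<in>T. c' i * c' j * M i j)"
    using assms by (intro sum.cong refl sum.mono_neutral_right) (auto simp: c'_def)
  also have "\<dots> = (\<Sum>i\<in>T. \<Sum>j\<in>T. c i * c j * M i j)"
    by (simp add: c'_def cong: sum.cong)
  finally show "0 \<le> (\<Sum>i\<in>T. \<Sum>j\<in>T. c i * c j * M i j)"
    using psd_on_nonneg[OF assms(1), of c'] by simp
qed

lemma psd_on_extend_zero:
  assumes "psd_on T M" "T \<subseteq> S" "finite S"
  shows "psd_on S (\<lambda>i j. if i \<in> T \<and> j \<in> T then M i j else 0)"
proof (rule psd_onI)
  show "(if i \<in> T \<and> j \<in> T then M i j else 0) = (if j \<in> T \<and> i \<in> T then M j i else 0)"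
    if "i \<in> S" "j \<in> S" for i j
    using assms that by (auto intro: psd_on_sym)
  fix c :: "'a \<Rightarrow> real"
  have "(\<Sum>i\<in>S. \<Sum>j\<in>S. c i * c j * (if i \<in> T \<and> j \<in> T then M i j else 0))
      = (\<Sum>i\<in>T. \<Sum>j\<in>S. c i * c j * (if i \<in> T \<and> j \<in> T then M i j else 0))"
    using assms by (intro sum.mono_neutral_right) auto
  also have "\<dots> = (\<Sum>i\<in>T. \<Sum>j\<in>T. c i * c j * (if i \<in> T \<and> j \<in> T then M i j else 0))"
    using assms by (intro sum.cong refl sum.mono_neutral_right) auto
  also have "\<dots> = (\<Sum>i\<in>T. \<Sum>j\<in>T. c i * c j * M i j)"
    by (simp cong: sum.cong)
  finally show "0 \<le> (\<Sum>i\<in>S. \<Sum>j\<in>S. c i * c j * (if i \<in> T \<and> j \<in> T then M i j else 0))"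
    using psd_on_nonneg[OF assms(1), of c] by simp
qed

lemma psd_on_identity:
  assumes "finite S"
  shows "psd_on S (\<lambda>i j. if i = j then 1 else 0)"
proof (rule psd_onI)
  fix c :: "'a \<Rightarrow> real"
  have "(\<Sum>i\<in>S. \<Sum>j\<in>S. c i * c j * (if i = j then 1 else 0)) = (\<Sum>i\<in>S. c i * c i)"
    using assms by (intro sum.cong refl) (simp add: if_distrib sum.delta cong: if_cong)
  then show "0 \<le> (\<Sum>i\<in>S. \<Sum>j\<in>S. c i * c j * (if i = j then 1 else 0))"
    by (simp add: sum_nonneg)
qed auto

lemma quadratic_form_insert:
  fixes M :: "'a \<Rightarrow> 'a \<Rightarrow> real"
  assumes "finite S" "a \<notin> S" "\<And>i. i \<in> S \<Longrightarrow> M a i = M i a"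
  shows "(\<Sum>i\<in>insert a S. \<Sum>j\<in>insert a S. c i * c j * M i j) =
    (c a)\<^sup>2 * M a a + 2 * c a * (\<Sum>i\<in>S. c i * M i a) + (\<Sum>i\<in>S. \<Sum>j\<in>S. c i * c j * M i j)"
proof -
  have "(\<Sum>j\<in>S. c a * c j * M a j) = c a * (\<Sum>i\<in>S. c i * M i a)"
    using assms(3) by (simp add: sum_distrib_left mult_ac cong: sum.cong)
  moreover have "(\<Sum>i\<in>S. c i * c a * M i a) = c a * (\<Sum>i\<in>S. c i * M i a)"
    by (simp add: sum_distrib_left mult_ac)
  ultimately show ?thesis
    using assms(1,2) by (simp add: sum.distrib power2_eq_square algebra_simps)
qed

text \<open>Cholesky factorisation. With \<open>x / 0 = 0\<close> the Schur complement also makes sense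
  for a zero pivot, whose row then vanishes.\<close>

lemma psd_on_factor:
  assumes "finite S" "psd_on S M"
  shows "\<exists>w. \<forall>i\<in>S. \<forall>j\<in>S. M i j = (\<Sum>l\<in>S. w i l * w j l)"
  using assms
proof (induction S arbitrary: M)
  case empty
  show ?case by simp
next
  case (insert a S)
  note psd = insert.prems
  define d where "d = M a a"
  have sym: "M a i = M i a" if "i \<in> S" for i
    using psd that by (auto intro: psd_on_sym)
  have quad: "0 \<le> (c a)\<^sup>2 * d + 2 * c a * (\<Sum>i\<in>S. c i * M i a) + (\<Sum>i\<in>S. \<Sum>j\<in>S. c i * c j * M i j)" for c
    using psd_on_nonneg[OF psd, of c] quadratic_form_insert[OF insert.hyps, where M = M and c = c] sym
    by (simp add: d_def)
  have "0 \<le> d"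
    using quad[of "\<lambda>i. if i = a then 1 else 0"] insert.hyps
    by (simp add: sum.neutral if_distrib cong: if_cong)
  have zero_row: "M i a = 0" if "i \<in> S" "d = 0" for i
  proof (rule ccontr)
    assume nz: "M i a \<noteq> 0"
    \<comment> \<open>Chosen so that the form at the vector with entry \<open>t\<close> at
      \<open>a\<close> and 1 at \<open>i\<close>, which is \<open>2 * t * M i a + M i i\<close> for
      a zero pivot, equals -1.\<close>
    define t where "t = - (1 + M i i) / (2 * M i a)"
    have ia: "i \<noteq> a" using that insert.hyps by auto
    define c where "c j = (if j = a then t else if j = i then 1 else 0)" for j
    have "(\<Sum>j\<in>S. c j * M j a) = (\<Sum>j\<in>{i}. c j * M j a)"
      using insert.hyps that by (intro sum.mono_neutral_right) (auto simp: c_def)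
    moreover have "(\<Sum>k\<in>S. \<Sum>j\<in>S. c k * c j * M k j) = (\<Sum>k\<in>{i}. \<Sum>j\<in>S. c k * c j * M k j)"
      using insert.hyps that by (intro sum.mono_neutral_right) (auto simp: c_def intro!: sum.neutral)
    moreover have "(\<Sum>j\<in>S. c i * c j * M i j) = (\<Sum>j\<in>{i}. c i * c j * M i j)"
      using insert.hyps that by (intro sum.mono_neutral_right) (auto simp: c_def)
    ultimately have "0 \<le> 2 * t * M i a + M i i"
      using quad[of c] that ia by (simp add: c_def)
    moreover have "2 * t * M i a = - (1 + M i i)" using nz by (simp add: t_def)
    ultimately show False by linarith
  qed
  define M' where "M' i j = M i j - M i a * M j a / d" for i j
  have "psd_on S M'"
  proof (rule psd_onI)
    show "M' i j = M' j i" if "i \<in> S" "j \<in> S" for i j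
      using psd_on_sym[OF psd, of i j] that by (simp add: M'_def mult.commute)
    fix c :: "'a \<Rightarrow> real"
    define b where "b = (\<Sum>i\<in>S. c i * M i a)"
    \<comment> \<open>The entry \<open>- b / d\<close> minimises the form in the coordinate
      \<open>a\<close>, so the form of \<open>M\<close> at \<open>c'\<close> is the form of
      \<open>M'\<close> at \<open>c\<close>. For \<open>d = 0\<close> the convention makes both
      corrections vanish.\<close>
    define c' where "c' i = (if i = a then - b / d else c i)" for i
    have on_S: "c' i = c i" if "i \<in> S" for i
      using that insert.hyps by (auto simp: c'_def)
    have "b\<^sup>2 = (\<Sum>i\<in>S. \<Sum>j\<in>S. c i * c j * (M i a * M j a))"
      by (simp add: b_def power2_eq_square sum_product mult_ac)
    then have "(\<Sum>i\<in>S. \<Sum>j\<in>S. c i * c j * M' i j) = (\<Sum>i\<in>S. \<Sum>j\<in>S. c i * c j * M i j) - b\<^sup>2 / d"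
      by (simp add: M'_def right_diff_distrib sum_subtractf sum_divide_distrib)
    moreover have "(c' a)\<^sup>2 * d + 2 * c' a * b = - b\<^sup>2 / d"
      by (cases "d = 0") (simp_all add: c'_def field_simps power2_eq_square)
    ultimately show "0 \<le> (\<Sum>i\<in>S. \<Sum>j\<in>S. c i * c j * M' i j)"
      using quad[of c'] by (simp add: on_S b_def cong: sum.cong)
  qed
  then obtain w where w: "\<And>i j. i \<in> S \<Longrightarrow> j \<in> S \<Longrightarrow> M' i j = (\<Sum>l\<in>S. w i l * w j l)"
    using insert.IH[of M'] by blast
  \<comment> \<open>A new coordinate \<open>a\<close> carries the scaled pivot column, and row
    \<open>a\<close> is zero in all other coordinates, as in a triangular factor.\<close>
  define w' where "w' i l = (if l = a then M i a / sqrt d else if i = a then 0 else w i l)" for i l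
  have on_S: "(\<Sum>l\<in>S. w' i l * w' j l) = (if i = a \<or> j = a then 0 else M' i j)"
    if "i \<in> insert a S" "j \<in> insert a S" for i j
  proof (cases "i = a \<or> j = a")
    case True
    then show ?thesis using insert.hyps by (auto simp: w'_def intro!: sum.neutral)
  next
    case False
    have "(\<Sum>l\<in>S. w' i l * w' j l) = (\<Sum>l\<in>S. w i l * w j l)"
      using False insert.hyps by (intro sum.cong) (auto simp: w'_def)
    then show ?thesis using False w that by simp
  qed
  have on_a: "w' i a * w' j a = M i a * M j a / d" for i j
    using \<open>0 \<le> d\<close> by (simp add: w'_def)
  have "M i j = (\<Sum>l\<in>insert a S. w' i l * w' j l)" if "i \<in> insert a S" "j \<in> insert a S" for i j
  proof -
    have "(\<Sum>l\<in>insert a S. w' i l * w' j l) = M i a * M j a / d + (if i = a \<or> j = a then 0 else M' i j)"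
      by (simp only: sum.insert[OF insert.hyps] on_a on_S[OF that])
    also have "\<dots> = M i j"
    proof (cases "i = a \<or> j = a")
      case True
      then have "M i j = M i a * M j a / d"
        using that zero_row[of i] zero_row[of j] sym[of i] sym[of j]
        by (cases "d = 0") (auto simp: d_def)
      then show ?thesis using True by (simp only: if_True add_0_right)
    next
      case False
      then show ?thesis by (simp add: M'_def)
    qed
    finally show ?thesis ..
  qed
  then show ?case by blast
qed

text \<open>Captures the three kinds of vector colouring at once: \<open>R\<close> and \<open>Q\<close> are the conditions imposed on
  the inner product plus \<open>1 / (k - 1)\<close> for adjacent and for non-adjacent vertices.\<close>

locale edge_condition =
  fixes R Q :: "real \<Rightarrow> bool"
  assumes R_nonpos: "R x \<Longrightarrow> x \<le> 0"
    and R_zero: "R 0"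
    and Q_nonneg: "0 \<le> x \<Longrightarrow> Q x"
    and R_scale: "R x \<Longrightarrow> 0 \<le> a \<Longrightarrow> R (a * x)"
    and Q_scale: "Q x \<Longrightarrow> 0 \<le> a \<Longrightarrow> Q (a * x)"
begin

definition colorable :: "nat set \<Rightarrow> nat set set \<Rightarrow> real \<Rightarrow> bool" where
  "colorable S E k \<longleftrightarrow> (\<exists>M. psd_on S M \<and> (\<forall>i\<in>S. M i i = 1) \<and>
     (\<forall>i\<in>S. \<forall>j\<in>S. i \<noteq> j \<longrightarrow>
        (if {i, j} \<in> E then R (M i j + 1 / (k - 1)) else Q (M i j + 1 / (k - 1)))))"

lemma colorable_empty: "colorable {} E k"
  by (auto simp: colorable_def psd_on_def)

lemma colorable_cong:
  assumes "\<And>i j. i \<in> S \<Longrightarrow> j \<in> S \<Longrightarrow> i \<noteq> j \<Longrightarrow> {i, j} \<in> E \<longleftrightarrow> {i, j} \<in> F"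
  shows "colorable S E k \<longleftrightarrow> colorable S F k"
proof -
  have *: "colorable S E k \<Longrightarrow> colorable S F k"
    if "\<And>i j. i \<in> S \<Longrightarrow> j \<in> S \<Longrightarrow> i \<noteq> j \<Longrightarrow> {i, j} \<in> E \<longleftrightarrow> {i, j} \<in> F" for E F
    using that unfolding colorable_def by metis
  show ?thesis using *[of E F] *[of F E] assms by blast
qed

lemma colorable_subset:
  assumes "colorable S E k" "T \<subseteq> S" "finite S"
  shows "colorable T E k"
  using assms unfolding colorable_def by (meson psd_on_subset subsetD)

text \<open>Mixing with the identity matrix shrinks all off-diagonal entries by
  \<open>(k - 1) / (l - 1)\<close>, which is exactly the factor taking \<open>1 / (k - 1)\<close> to
  \<open>1 / (l - 1)\<close>; both edge conditions survive such a scaling.\<close>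

lemma colorable_mono:
  assumes "colorable S E k" "1 < k" "k \<le> l" "finite S"
  shows "colorable S E l"
proof -
  obtain M where M: "psd_on S M" "\<And>i. i \<in> S \<Longrightarrow> M i i = 1"
    "\<And>i j. i \<in> S \<Longrightarrow> j \<in> S \<Longrightarrow> i \<noteq> j \<Longrightarrow>
      (if {i, j} \<in> E then R (M i j + 1 / (k - 1)) else Q (M i j + 1 / (k - 1)))"
    using assms(1) unfolding colorable_def by blast
  define a where "a = (k - 1) / (l - 1)"
  have a: "0 \<le> a" "a \<le> 1" using assms by (auto simp: a_def)
  define N where "N i j = a * M i j + (1 - a) * (if i = j then 1 else 0)" for i j
  have "psd_on S N"
    unfolding N_def using M(1) a assms(4)
    by (intro psd_on_add psd_on_scale psd_on_identity) auto
  moreover have "N i j + 1 / (l - 1) = a * (M i j + 1 / (k - 1))" if "i \<noteq> j" for i j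
  proof -
    have "1 / (l - 1) = a * (1 / (k - 1))"
      using assms(2,3) by (simp add: a_def)
    then show ?thesis using that by (simp add: N_def distrib_left)
  qed
  ultimately show ?thesis
    unfolding colorable_def using M(2,3) R_scale Q_scale a(1)
    by (intro exI[of _ N]) (auto simp: N_def split: if_splits)
qed

text \<open>The two colourings are placed in orthogonal spaces. The inner product 0 between them is
  acceptable for non-adjacent pairs only, whence the hypothesis \<open>no_edge\<close>.\<close>

lemma colorable_disjoint_Un:
  assumes "colorable S E k" "colorable T E k" "finite S" "finite T" "S \<inter> T = {}" "1 < k"
    and no_edge: "\<And>i j. i \<in> S \<Longrightarrow> j \<in> T \<Longrightarrow> {i, j} \<notin> E"
  shows "colorable (S \<union> T) E k"
proof -
  obtain M where M: "psd_on S M" "\<And>i. i \<in> S \<Longrightarrow> M i i = 1"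
    "\<And>i j. i \<in> S \<Longrightarrow> j \<in> S \<Longrightarrow> i \<noteq> j \<Longrightarrow>
      (if {i, j} \<in> E then R (M i j + 1 / (k - 1)) else Q (M i j + 1 / (k - 1)))"
    using assms(1) unfolding colorable_def by blast
  obtain N where N: "psd_on T N" "\<And>i. i \<in> T \<Longrightarrow> N i i = 1"
    "\<And>i j. i \<in> T \<Longrightarrow> j \<in> T \<Longrightarrow> i \<noteq> j \<Longrightarrow>
      (if {i, j} \<in> E then R (N i j + 1 / (k - 1)) else Q (N i j + 1 / (k - 1)))"
    using assms(2) unfolding colorable_def by blast
  define L where "L i j = (if i \<in> S \<and> j \<in> S then M i j else 0) + (if i \<in> T \<and> j \<in> T then N i j else 0)" for i j
  have psd: "psd_on (S \<union> T) L"
    unfolding L_def using M(1) N(1) assms by (intro psd_on_add psd_on_extend_zero) auto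
  have LS: "L i j = M i j" if "i \<in> S" "j \<in> S" for i j
    using that assms(5) by (auto simp: L_def)
  have LT: "L i j = N i j" if "i \<in> T" "j \<in> T" for i j
    using that assms(5) by (auto simp: L_def)
  have ST: "L i j = 0 \<and> L j i = 0 \<and> {i, j} \<notin> E \<and> {j, i} \<notin> E" if "i \<in> S" "j \<in> T" for i j
    using that assms(5) no_edge[OF that] by (auto simp: L_def insert_commute)
  have Q: "Q (0 + 1 / (k - 1))" using assms(6) by (intro Q_nonneg) simp
  have "if {i, j} \<in> E then R (L i j + 1 / (k - 1)) else Q (L i j + 1 / (k - 1))"
    if ij: "i \<in> S \<union> T" "j \<in> S \<union> T" "i \<noteq> j" for i j
  proof -
    consider "i \<in> S" "j \<in> S" | "i \<in> T" "j \<in> T" | "i \<in> S" "j \<in> T" | "i \<in> T" "j \<in> S"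
      using ij by blast
    then show ?thesis
    proof cases
      case 1 then show ?thesis using M(3) LS ij(3) by metis
    next
      case 2 then show ?thesis using N(3) LT ij(3) by metis
    next
      case 3 then show ?thesis using ST[of i j] Q by simp
    next
      case 4 then show ?thesis using ST[of j i] Q by simp
    qed
  qed
  then show ?thesis
    unfolding colorable_def using psd LS LT M(2) N(2) by (intro exI[of _ L]) auto
qed

text \<open>All of \<open>I\<close> receives one new unit vector, towards which the old vectors are tilted
  until their inner product with it is \<open>-1 / k\<close>.\<close>

lemma colorable_add_independent:
  assumes "colorable S E k" "finite S" "finite I" "S \<inter> I = {}" "1 < k"
    and indep: "\<And>i j. i \<in> I \<Longrightarrow> j \<in> I \<Longrightarrow> {i, j} \<notin> E"
  shows "colorable (S \<union> I) E (k + 1)"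
proof -
  obtain M where M: "psd_on S M" "\<And>i. i \<in> S \<Longrightarrow> M i i = 1"
    "\<And>i j. i \<in> S \<Longrightarrow> j \<in> S \<Longrightarrow> i \<noteq> j \<Longrightarrow>
      (if {i, j} \<in> E then R (M i j + 1 / (k - 1)) else Q (M i j + 1 / (k - 1)))"
    using assms(1) unfolding colorable_def by blast
  define u where "u i = (if i \<in> I then 1 else - 1 / k)" for i
  \<comment> \<open>The squared length left to an old vector once its component along the new
    direction is \<open>- 1 / k\<close>. The identity
    \<open>1 / k\<^sup>2 + 1 / k = a / (k - 1)\<close> then moves the target from \<open>k\<close>
    to \<open>k + 1\<close>.\<close>
  define a where "a = 1 - 1 / k\<^sup>2"
  have a: "0 \<le> a" using assms(5) by (simp add: a_def)
  define L where "L i j = u i * u j + a * (if i \<in> S \<and> j \<in> S then M i j else 0)" for i j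
  have psd: "psd_on (S \<union> I) L"
    unfolding L_def using M(1) a assms
    by (intro psd_on_add psd_on_extend_zero psd_on_scale psd_on_rank_one) auto
  have diag: "L i i = 1" if "i \<in> S \<union> I" for i
    using that M(2) assms(4) by (auto simp: L_def u_def a_def power2_eq_square)
  have LS: "L i j + 1 / k = a * (M i j + 1 / (k - 1))" if "i \<in> S" "j \<in> S" for i j
  proof -
    have "1 / k\<^sup>2 + 1 / k = a * (1 / (k - 1))"
      using assms(5) by (simp add: a_def field_simps power2_eq_square)
    moreover have "L i j = 1 / k\<^sup>2 + a * M i j"
      using that assms(4) by (auto simp: L_def u_def power2_eq_square)
    ultimately show ?thesis by (simp add: algebra_simps)
  qed
  have LI: "L i j = 1 \<and> {i, j} \<notin> E" if "i \<in> I" "j \<in> I" for i j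
    using that assms(4) indep by (auto simp: L_def u_def)
  have SI: "L i j + 1 / k = 0" "L j i + 1 / k = 0" if "i \<in> S" "j \<in> I" for i j
    using that assms(4) by (auto simp: L_def u_def)
  have "if {i, j} \<in> E then R (L i j + 1 / k) else Q (L i j + 1 / k)"
    if ij: "i \<in> S \<union> I" "j \<in> S \<union> I" "i \<noteq> j" for i j
  proof -
    consider "i \<in> S" "j \<in> S" | "i \<in> I" "j \<in> I" | "i \<in> S" "j \<in> I" | "i \<in> I" "j \<in> S"
      using ij by blast
    then show ?thesis
    proof cases
      case 1
      then show ?thesis using M(3)[of i j] LS[of i j] ij(3) R_scale Q_scale a by metis
    next
      case 2 then show ?thesis using LI[of i j] Q_nonneg assms(5) by simp
    next
      case 3 then show ?thesis using SI[of i j] R_zero Q_nonneg by simp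
    next
      case 4 then show ?thesis using SI[of j i] R_zero Q_nonneg by simp
    qed
  qed
  then show ?thesis
    unfolding colorable_def using psd diag by (intro exI[of _ L]) auto
qed

lemma colorable_three:
  fixes f :: "nat \<Rightarrow> nat"
  assumes "finite S" "\<And>i. i \<in> S \<Longrightarrow> f i < 3"
    and proper: "\<And>i j. i \<in> S \<Longrightarrow> j \<in> S \<Longrightarrow> i \<noteq> j \<Longrightarrow> {i, j} \<in> E \<Longrightarrow> f i \<noteq> f j"
  shows "colorable S E 3"
proof -
  \<comment> \<open>After the factor 2/3 these are the corners of an equilateral triangle on the
    unit circle, written in three coordinates: inner product 1 for equal and -1/2 for different
    colours.\<close>
  define u where "u l i = (if f i = l then 1 else - 1 / 2 :: real)" for l i
  define L where "L i j = 2 / 3 * (\<Sum>l<3. u l i * u l j)" for i j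
  have psd: "psd_on S L"
    unfolding L_def by (intro psd_on_scale psd_on_sum psd_on_rank_one) auto
  have val: "L i j = (if f i = f j then 1 else - 1 / 2)" if "i \<in> S" "j \<in> S" for i j
  proof -
    have "f i = 0 \<or> f i = 1 \<or> f i = 2" "f j = 0 \<or> f j = 1 \<or> f j = 2"
      using that assms(2)[of i] assms(2)[of j] by linarith+
    moreover have "(\<Sum>l<3. u l i * u l j) = u 0 i * u 0 j + u 1 i * u 1 j + u 2 i * u 2 j"
      by (simp add: eval_nat_numeral)
    ultimately show ?thesis by (auto simp: L_def u_def)
  qed
  have "if {i, j} \<in> E then R (L i j + 1 / (3 - 1)) else Q (L i j + 1 / (3 - 1))"
    if "i \<in> S" "j \<in> S" "i \<noteq> j" for i j
    using proper[OF that] R_zero by (auto simp: val[OF that(1,2)] intro: Q_nonneg)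
  then show ?thesis
    unfolding colorable_def using psd val by (intro exI[of _ L] conjI ballI impI) (blast | simp)+
qed

text \<open>A crude bound that makes the set under the infimum nonempty. Vertices are added one by
  one as independent sets, starting from 2 because that step needs \<open>1 < k\<close>.\<close>

lemma colorable_card:
  assumes "finite S" "\<And>i. i \<in> S \<Longrightarrow> {i} \<notin> E"
  shows "colorable S E (2 + real (card S))"
  using assms
proof (induction S)
  case empty
  show ?case by (simp add: colorable_empty)
next
  case (insert x S)
  have "colorable (S \<union> {x}) E (2 + real (card S) + 1)"
    using insert by (intro colorable_add_independent) auto
  then show ?case using insert.hyps by (simp add: add_ac)
qed

end

section \<open>Expectation over a random edge set\<close>

text \<open>The ground set is left arbitrary because the same expectation with
  \<open>p = 1/2\<close>, over subsets of the coordinates, later serves as a uniformly random sign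
  vector.\<close>

definition edge_exp :: "'a set \<Rightarrow> real \<Rightarrow> ('a set \<Rightarrow> real) \<Rightarrow> real" where
  "edge_exp A p f = (\<Sum>E\<in>Pow A. p ^ card E * (1 - p) ^ (card A - card E) * f E)"

lemma gnp_prob_eq_edge_exp: "gnp_prob n p P = edge_exp (all_pairs n) p (\<lambda>E. of_bool (P E))"
  unfolding gnp_prob_def edge_exp_def by (intro sum.cong) auto

lemma edge_exp_cong: "(\<And>E. E \<subseteq> A \<Longrightarrow> f E = g E) \<Longrightarrow> edge_exp A p f = edge_exp A p g"
  unfolding edge_exp_def by (intro sum.cong) auto

lemma edge_exp_mono:
  assumes "0 \<le> p" "p \<le> 1" "\<And>E. E \<subseteq> A \<Longrightarrow> f E \<le> g E"
  shows "edge_exp A p f \<le> edge_exp A p g"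
  unfolding edge_exp_def using assms by (intro sum_mono mult_left_mono) auto

lemma edge_exp_add: "edge_exp A p (\<lambda>E. f E + g E) = edge_exp A p f + edge_exp A p g"
  by (simp add: edge_exp_def distrib_left sum.distrib)

lemma edge_exp_cmult: "edge_exp A p (\<lambda>E. c * f E) = c * edge_exp A p f"
  by (simp add: edge_exp_def sum_distrib_left mult_ac)

lemma edge_exp_sum: "edge_exp A p (\<lambda>E. \<Sum>i\<in>I. f i E) = (\<Sum>i\<in>I. edge_exp A p (f i))"
  unfolding edge_exp_def sum_distrib_left by (rule sum.swap)

lemma edge_exp_empty [simp]: "edge_exp {} p f = f {}"
  by (simp add: edge_exp_def)

lemma edge_exp_insert:
  assumes "finite A" "a \<notin> A"
  shows "edge_exp (insert a A) p f = p * edge_exp A p (\<lambda>E. f (insert a E)) + (1 - p) * edge_exp A p f"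
proof -
  have inj: "inj_on (insert a) (Pow A)"
    using assms(2) by (auto simp: inj_on_def)
  have disj: "Pow A \<inter> insert a ` Pow A = {}"
    using assms(2) by auto
  have 1: "(\<Sum>E\<in>Pow A. p ^ card E * (1 - p) ^ (card (insert a A) - card E) * f E) = (1 - p) * edge_exp A p f"
    unfolding edge_exp_def sum_distrib_left
  proof (rule sum.cong)
    fix E assume "E \<in> Pow A"
    then have "card E \<le> card A" using assms(1) by (simp add: card_mono)
    then show "p ^ card E * (1 - p) ^ (card (insert a A) - card E) * f E
        = (1 - p) * (p ^ card E * (1 - p) ^ (card A - card E) * f E)"
      using assms by (simp add: Suc_diff_le)
  qed simp
  have 2: "(\<Sum>E\<in>insert a ` Pow A. p ^ card E * (1 - p) ^ (card (insert a A) - card E) * f E)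
      = p * edge_exp A p (\<lambda>E. f (insert a E))"
    unfolding edge_exp_def sum_distrib_left sum.reindex[OF inj] comp_def
  proof (rule sum.cong)
    fix E assume "E \<in> Pow A"
    then have "finite E" "a \<notin> E" using assms finite_subset by auto
    then show "p ^ card (insert a E) * (1 - p) ^ (card (insert a A) - card (insert a E)) * f (insert a E)
        = p * (p ^ card E * (1 - p) ^ (card A - card E) * f (insert a E))"
      using assms by simp
  qed simp
  show ?thesis
    using assms(1) disj 1 2
    by (subst edge_exp_def) (simp add: Pow_insert sum.union_disjoint)
qed

lemma edge_exp_Un:
  assumes "finite A" "finite B" "A \<inter> B = {}"
  shows "edge_exp (A \<union> B) p f = edge_exp A p (\<lambda>E. edge_exp B p (\<lambda>F. f (E \<union> F)))"
  using assms(1,3)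
proof (induction A arbitrary: f)
  case (insert a A)
  then show ?case using assms(2) by (simp add: edge_exp_insert)
qed simp

lemma edge_exp_const [simp]:
  assumes "finite A"
  shows "edge_exp A p (\<lambda>E. c) = c"
  using assms by (induction A) (simp_all add: edge_exp_insert algebra_simps)

text \<open>Independence of the elements; with exponentials for \<open>g\<close> this is the moment
  generating function behind the Chernoff bound.\<close>

lemma edge_exp_prod:
  assumes "finite A"
  shows "edge_exp A p (\<lambda>E. \<Prod>e\<in>E. g e) = (\<Prod>e\<in>A. 1 - p + p * g e)"
  using assms
proof (induction A)
  case (insert a A)
  have "edge_exp A p (\<lambda>E. \<Prod>e\<in>insert a E. g e) = edge_exp A p (\<lambda>E. g a * (\<Prod>e\<in>E. g e))"
  proof (rule edge_exp_cong)
    fix E assume "E \<subseteq> A"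
    then have "finite E" "a \<notin> E" using insert.hyps finite_subset by auto
    then show "(\<Prod>e\<in>insert a E. g e) = g a * (\<Prod>e\<in>E. g e)" by simp
  qed
  then show ?case using insert by (simp add: edge_exp_insert edge_exp_cmult algebra_simps)
qed simp

lemma edge_exp_superset:
  assumes "finite A" "F \<subseteq> A"
  shows "edge_exp A p (\<lambda>E. of_bool (F \<subseteq> E)) = p ^ card F"
  using finite_subset[OF assms(2,1)] assms
proof (induction F arbitrary: A)
  case (insert a F)
  define B where "B = A - {a}"
  have B: "A = insert a B" "a \<notin> B" "finite B" "F \<subseteq> B"
    using insert by (auto simp: B_def)
  have "edge_exp B p (\<lambda>E. of_bool (insert a F \<subseteq> insert a E)) = edge_exp B p (\<lambda>E. of_bool (F \<subseteq> E))"
    using insert.hyps by (intro edge_exp_cong) auto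
  moreover have "edge_exp B p (\<lambda>E. of_bool (insert a F \<subseteq> E)) = edge_exp B p (\<lambda>E. 0)"
    using B by (intro edge_exp_cong) auto
  ultimately show ?case
    using insert.IH[OF B(3,4)] insert.hyps B by (simp add: edge_exp_insert)
qed simp

text \<open>Some outcome does not exceed the mean; this extracts a concrete sign vector from the
  random rounding.\<close>

lemma edge_exp_ge_min:
  assumes "finite A" "0 \<le> p" "p \<le> 1"
  obtains E where "E \<subseteq> A" "f E \<le> edge_exp A p f"
proof -
  obtain E where E: "E \<in> Pow A" "\<And>F. F \<in> Pow A \<Longrightarrow> f E \<le> f F"
    using arg_min_if_finite[of "Pow A" f] assms(1) Pow_not_empty by (metis finite_Pow_iff not_less)
  have "edge_exp A p (\<lambda>F. f E) \<le> edge_exp A p f"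
    using assms E by (intro edge_exp_mono) auto
  then show ?thesis using that E assms(1) by simp
qed

lemma edge_exp_union_bound:
  assumes "0 \<le> p" "p \<le> 1" "finite I" "\<And>E. E \<subseteq> A \<Longrightarrow> P E \<Longrightarrow> \<exists>i\<in>I. Q i E"
  shows "edge_exp A p (\<lambda>E. of_bool (P E)) \<le> (\<Sum>i\<in>I. edge_exp A p (\<lambda>E. of_bool (Q i E)))"
  unfolding edge_exp_sum[symmetric]
proof (rule edge_exp_mono[OF assms(1,2)])
  fix E assume "E \<subseteq> A"
  show "of_bool (P E) \<le> (\<Sum>i\<in>I. of_bool (Q i E) :: real)"
  proof (cases "P E")
    case True
    then obtain i where "i \<in> I" "Q i E" using assms(4) \<open>E \<subseteq> A\<close> by blast
    then show ?thesis
      using member_le_sum[of i I "\<lambda>i. of_bool (Q i E) :: real"] assms(3) True by simp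
  qed (simp add: sum_nonneg)
qed

lemma edge_exp_variance:
  assumes "finite A"
  shows "edge_exp A p (\<lambda>E. (f E - c)\<^sup>2) = edge_exp A p (\<lambda>E. (f E)\<^sup>2) - 2 * c * edge_exp A p f + c\<^sup>2"
proof -
  have "edge_exp A p (\<lambda>E. (f E - c)\<^sup>2) = edge_exp A p (\<lambda>E. (f E)\<^sup>2 + ((- 2 * c) * f E + c\<^sup>2))"
    by (rule edge_exp_cong) (simp add: power2_eq_square algebra_simps)
  also have "\<dots> = edge_exp A p (\<lambda>E. (f E)\<^sup>2) + (- 2 * c * edge_exp A p f + c\<^sup>2)"
    unfolding edge_exp_add edge_exp_cmult using assms by simp
  finally show ?thesis by simp
qed

text \<open>Efron--Stein: conditioning on all blocks but one, the variance splits into a within-block part,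
  which is at most 1, and the variance of the conditional mean, which is again Lipschitz.\<close>

lemma edge_exp_variance_blocks:
  fixes f :: "'a set \<Rightarrow> real"
  assumes "finite J" "0 \<le> p" "p \<le> 1" "\<And>j. j \<in> J \<Longrightarrow> finite (B j)" "disjoint_family_on B J"
    and "\<And>j E F. j \<in> J \<Longrightarrow> E \<subseteq> (\<Union>j\<in>J. B j) \<Longrightarrow> F \<subseteq> (\<Union>j\<in>J. B j) \<Longrightarrow>
      E - B j = F - B j \<Longrightarrow> \<bar>f E - f F\<bar> \<le> 1"
  shows "edge_exp (\<Union>j\<in>J. B j) p (\<lambda>E. (f E)\<^sup>2) - (edge_exp (\<Union>j\<in>J. B j) p f)\<^sup>2 \<le> card J"
  using assms(1,4-)
proof (induction J arbitrary: f)
  case (insert j J)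
  define U where "U = (\<Union>j\<in>J. B j)"
  define g where "g E = edge_exp (B j) p (\<lambda>F. f (E \<union> F))" for E
  have fin: "finite U" "finite (B j)" and disj: "U \<inter> B j = {}"
    using insert by (auto simp: U_def disjoint_family_on_def)
  have split: "edge_exp (\<Union>j\<in>insert j J. B j) p h = edge_exp U p (\<lambda>E. edge_exp (B j) p (\<lambda>F. h (E \<union> F)))" for h
    using edge_exp_Un[OF fin disj, of p h] by (simp add: U_def Un_commute)
  have lip: "\<bar>f E - f F\<bar> \<le> 1" if "i \<in> insert j J" "E \<subseteq> U \<union> B j" "F \<subseteq> U \<union> B j" "E - B i = F - B i" for i E F
    using insert.prems(3)[OF that(1)] that by (auto simp: U_def Un_commute)
  have within: "edge_exp (B j) p (\<lambda>F. (f (E \<union> F))\<^sup>2) \<le> (g E)\<^sup>2 + 1" if "E \<subseteq> U" for E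
  proof -
    \<comment> \<open>Any reference value serves, since the mean minimises the mean square
      deviation. The value with block \<open>B j\<close> empty is within 1 of all the
      others.\<close>
    define c where "c = f E"
    have "edge_exp (B j) p (\<lambda>F. (f (E \<union> F) - c)\<^sup>2) \<le> edge_exp (B j) p (\<lambda>F. 1)"
    proof (rule edge_exp_mono[OF assms(2,3)])
      fix F assume "F \<subseteq> B j"
      then have "\<bar>f (E \<union> F) - f E\<bar> \<le> 1"
        using that disj by (intro lip[of j]) auto
      then show "(f (E \<union> F) - c)\<^sup>2 \<le> 1"
        unfolding c_def by (simp add: abs_square_le_1)
    qed
    then have "edge_exp (B j) p (\<lambda>F. (f (E \<union> F))\<^sup>2) - 2 * c * g E + c\<^sup>2 \<le> 1"
      using fin edge_exp_variance[OF fin(2), of p "\<lambda>F. f (E \<union> F)" c] by (simp add: g_def)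
    moreover have "0 \<le> (g E - c)\<^sup>2" by simp
    ultimately show ?thesis by (simp add: power2_eq_square algebra_simps)
  qed
  have "\<bar>g E - g F\<bar> \<le> 1" if "i \<in> J" "E \<subseteq> U" "F \<subseteq> U" "E - B i = F - B i" for i E F
  proof -
    have "edge_exp (B j) p (\<lambda>H. f (E \<union> H)) \<le> edge_exp (B j) p (\<lambda>H. f (F \<union> H) + 1)"
      "edge_exp (B j) p (\<lambda>H. f (F \<union> H)) \<le> edge_exp (B j) p (\<lambda>H. f (E \<union> H) + 1)"
    proof (rule_tac [!] edge_exp_mono[OF assms(2,3)])
      fix H assume "H \<subseteq> B j"
      then have "\<bar>f (E \<union> H) - f (F \<union> H)\<bar> \<le> 1"
        using that by (intro lip[of i]) auto
      then show "f (E \<union> H) \<le> f (F \<union> H) + 1" "f (F \<union> H) \<le> f (E \<union> H) + 1" by linarith+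
    qed
    then show ?thesis using fin by (simp add: g_def edge_exp_add abs_le_iff)
  qed
  then have "edge_exp U p (\<lambda>E. (g E)\<^sup>2) - (edge_exp U p g)\<^sup>2 \<le> card J"
    unfolding U_def using insert.prems by (intro insert.IH) (auto simp: disjoint_family_on_def)
  moreover have "edge_exp U p (\<lambda>E. edge_exp (B j) p (\<lambda>F. (f (E \<union> F))\<^sup>2)) \<le> edge_exp U p (\<lambda>E. (g E)\<^sup>2 + 1)"
    using within by (intro edge_exp_mono assms)
  ultimately show ?case
    using insert.hyps fin by (simp only: split) (simp add: edge_exp_add g_def[symmetric] g_def[abs_def,symmetric])
qed simp

lemma edge_exp_chebyshev:
  assumes "finite A" "0 \<le> p" "p \<le> 1" "0 < t"
    and "edge_exp A p (\<lambda>E. (f E)\<^sup>2) - (edge_exp A p f)\<^sup>2 \<le> v"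
    and "\<And>E. E \<subseteq> A \<Longrightarrow> P E \<Longrightarrow> t \<le> \<bar>f E - edge_exp A p f\<bar>"
  shows "t\<^sup>2 * edge_exp A p (\<lambda>E. of_bool (P E)) \<le> v"
proof -
  define m where "m = edge_exp A p f"
  have "t\<^sup>2 * edge_exp A p (\<lambda>E. of_bool (P E)) \<le> edge_exp A p (\<lambda>E. (f E - m)\<^sup>2)"
    unfolding edge_exp_cmult[symmetric]
  proof (rule edge_exp_mono[OF assms(2,3)])
    fix E assume "E \<subseteq> A"
    show "t\<^sup>2 * of_bool (P E) \<le> (f E - m)\<^sup>2"
    proof (cases "P E")
      case True
      then have "t\<^sup>2 \<le> \<bar>f E - m\<bar>\<^sup>2"
        using assms \<open>E \<subseteq> A\<close> by (intro power_mono) (auto simp: m_def)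
      then show ?thesis using True by simp
    qed simp
  qed
  also have "\<dots> \<le> v"
    using assms(5) edge_exp_variance[OF assms(1), of p f m] by (simp add: m_def power2_eq_square)
  finally show ?thesis .
qed

text \<open>Each pair is charged to its larger endpoint. This partitions the pairs into independent
  blocks, and deleting \<open>m\<close> makes block \<open>m\<close> irrelevant, which gives the
  Lipschitz property.\<close>

definition star :: "nat \<Rightarrow> nat set set" where
  "star m = (\<lambda>i. {i, m}) ` {1..<m}"

lemma all_pairs_eq: "all_pairs n = {e. e \<subseteq> {1..n} \<and> card e = 2}"
proof (intro set_eqI iffI)
  fix e assume "e \<in> {e. e \<subseteq> {1..n} \<and> card e = 2}"
  then obtain i j where "e = {i, j}" "i \<noteq> j" "i \<in> {1..n}" "j \<in> {1..n}"
    by (auto simp: card_2_iff)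
  then show "e \<in> all_pairs n" unfolding all_pairs_def by blast
qed (auto simp: all_pairs_def)

lemma finite_all_pairs [simp]: "finite (all_pairs n)"
  by (rule finite_subset[of _ "Pow {1..n}"]) (auto simp: all_pairs_eq)

lemma finite_star [simp]: "finite (star m)"
  by (simp add: star_def)

lemma star_disjoint: "disjoint_family_on star J"
  unfolding disjoint_family_on_def star_def by (auto simp: doubleton_eq_iff)

lemma all_pairs_star: "all_pairs n = (\<Union>m\<in>{1..n}. star m)"
proof
  show "all_pairs n \<subseteq> (\<Union>m\<in>{1..n}. star m)"
  proof
    fix e assume "e \<in> all_pairs n"
    then obtain i j where e: "e = {i, j}" "i \<in> {1..n}" "j \<in> {1..n}" "i \<noteq> j"
      by (auto simp: all_pairs_def)
    then have "e \<in> star j \<or> e \<in> star i"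
      by (auto simp: star_def image_iff doubleton_eq_iff)
    then show "e \<in> (\<Union>m\<in>{1..n}. star m)" using e by blast
  qed
  show "(\<Union>m\<in>{1..n}. star m) \<subseteq> all_pairs n"
    by (auto simp: star_def all_pairs_def) (metis atLeastAtMost_iff le_trans less_imp_le nat_neq_iff)
qed

text \<open>Expansion of a square. For signs \<open>x\<close> it shows that no cut of the complete
  graph has a large surplus; for \<open>x = 1\<close> it counts the pairs.\<close>

lemma sum_all_pairs_prod:
  fixes x :: "nat \<Rightarrow> real"
  shows "2 * (\<Sum>e\<in>all_pairs n. \<Prod>i\<in>e. x i) = (\<Sum>i\<in>{1..n}. x i)\<^sup>2 - (\<Sum>i\<in>{1..n}. (x i)\<^sup>2)"
proof (induction n)
  case 0
  show ?case by (simp add: all_pairs_star)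
next
  case (Suc n)
  have "all_pairs (Suc n) = all_pairs n \<union> star (Suc n)"
    by (auto simp: all_pairs_star atLeastAtMostSuc_conv)
  moreover have "all_pairs n \<inter> star (Suc n) = {}"
    by (auto simp: all_pairs_eq star_def)
  moreover have "(\<Sum>e\<in>star (Suc n). \<Prod>i\<in>e. x i) = x (Suc n) * (\<Sum>i\<in>{1..n}. x i)"
  proof -
    have "inj_on (\<lambda>i. {i, Suc n}) {1..<Suc n}"
      by (auto simp: inj_on_def doubleton_eq_iff)
    then have "(\<Sum>e\<in>star (Suc n). \<Prod>i\<in>e. x i) = (\<Sum>i\<in>{1..<Suc n}. \<Prod>l\<in>{i, Suc n}. x l)"
      unfolding star_def by (subst sum.reindex) auto
    also have "\<dots> = (\<Sum>i\<in>{1..n}. x i * x (Suc n))"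
      by (intro sum.cong) auto
    finally show ?thesis by (simp add: sum_distrib_left mult.commute)
  qed
  ultimately show ?case
    using Suc by (simp add: sum.union_disjoint power2_eq_square algebra_simps)
qed

lemma card_all_pairs: "2 * real (card (all_pairs n)) = (real n)\<^sup>2 - real n"
  using sum_all_pairs_prod[of "\<lambda>_. 1" n] by simp

section \<open>Local repair and random rounding\<close>

definition edges_in :: "'a set set \<Rightarrow> 'a set \<Rightarrow> 'a set set" where
  "edges_in E W = {e \<in> E. e \<subseteq> W}"

text \<open>The hypothesis makes every subset contain a vertex of degree at most 2, which is coloured last.\<close>

lemma three_coloring_sparse:
  fixes E :: "nat set set"
  assumes "finite W" "\<And>e. e \<in> E \<Longrightarrow> card e = 2"
    and "\<And>U. U \<subseteq> W \<Longrightarrow> U \<noteq> {} \<Longrightarrow> 2 * card (edges_in E U) < 3 * card U"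
  shows "\<exists>f. (\<forall>i\<in>W. f i < 3) \<and> (\<forall>i\<in>W. \<forall>j\<in>W. {i, j} \<in> E \<longrightarrow> f i \<noteq> (f j :: nat))"
  using assms(1,3)
proof (induction W rule: finite_psubset_induct)
  case (psubset W)
  show ?case
  proof (cases "W = {}")
    case False
    define D where "D v = {e \<in> edges_in E W. v \<in> e}" for v
    have fin: "finite (edges_in E W)"
      using psubset.hyps by (auto simp: edges_in_def intro: rev_finite_subset[of "Pow W"])
    have "{v \<in> W. v \<in> e} = e" if "e \<in> edges_in E W" for e
      using that by (auto simp: edges_in_def)
    then have "(\<Sum>v\<in>W. card (D v)) = 2 * card (edges_in E W)"
      unfolding D_def using psubset.hyps fin assms(2)
      by (intro sum_multicount) (auto simp: edges_in_def)
    also have "\<dots> < 3 * card W"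
      using psubset.prems[OF subset_refl False] .
    finally have "(\<Sum>v\<in>W. card (D v)) < 3 * card W" .
    moreover have "3 * card W \<le> (\<Sum>v\<in>W. card (D v))" if "\<And>v. v \<in> W \<Longrightarrow> 3 \<le> card (D v)"
      using sum_mono[OF that, of W "\<lambda>v. v"] by simp
    ultimately obtain v where v: "v \<in> W" "card (D v) < 3"
      by (meson not_less)
    obtain f :: "nat \<Rightarrow> nat" where f: "\<And>i. i \<in> W - {v} \<Longrightarrow> f i < 3"
      "\<And>i j. i \<in> W - {v} \<Longrightarrow> j \<in> W - {v} \<Longrightarrow> {i, j} \<in> E \<Longrightarrow> f i \<noteq> f j"
      using psubset.IH[of "W - {v}"] psubset.prems v(1) by blast
    define N where "N = {j \<in> W - {v}. {v, j} \<in> E}"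
    have "card N \<le> card (D v)"
    proof (rule card_inj_on_le)
      show "inj_on (\<lambda>j. {v, j}) N" by (auto simp: inj_on_def doubleton_eq_iff)
      show "(\<lambda>j. {v, j}) ` N \<subseteq> D v" using v(1) by (auto simp: N_def D_def edges_in_def)
      show "finite (D v)" using fin by (simp add: D_def)
    qed
    moreover have "finite N" using psubset.hyps by (simp add: N_def)
    ultimately have "card (f ` N) < card {..<3::nat}"
      using v(2) card_image_le[of N f] by simp
    then have "\<not> {..<3} \<subseteq> f ` N"
      using card_mono[of "f ` N" "{..<3}"] \<open>finite N\<close> by auto
    then obtain c where c: "c < 3" "c \<notin> f ` N" by blast
    have no_loop: "{v, v} \<notin> E" using assms(2)[of "{v}"] by auto
    have "(f(v := c)) i \<noteq> (f(v := c)) j" if "i \<in> W" "j \<in> W" "{i, j} \<in> E" for i j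
    proof -
      have "i \<noteq> v \<or> j \<noteq> v" using that no_loop by auto
      moreover have "f j \<noteq> c" if "i = v" "j \<noteq> v"
      proof -
        have "j \<in> N" using that \<open>j \<in> W\<close> \<open>{i, j} \<in> E\<close> by (simp add: N_def)
        then show ?thesis using c(2) by blast
      qed
      moreover have "f i \<noteq> c" if "j = v" "i \<noteq> v"
      proof -
        have "i \<in> N" using that \<open>i \<in> W\<close> \<open>{i, j} \<in> E\<close> by (simp add: N_def doubleton_eq_iff insert_commute)
        then show ?thesis using c(2) by blast
      qed
      moreover have "f i \<noteq> f j" if "i \<noteq> v" "j \<noteq> v"
        using that \<open>i \<in> W\<close> \<open>j \<in> W\<close> \<open>{i, j} \<in> E\<close> by (intro f(2)) auto
      ultimately show ?thesis by (cases "i = v"; cases "j = v") auto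
    qed
    moreover have "(f(v := c)) i < 3" if "i \<in> W" for i
      using f(1)[of i] c(1) that by simp
    ultimately show ?thesis by blast
  qed simp
qed

text \<open>As long as two adjacent vertices outside \<open>W\<close> have neighbours in \<open>W\<close>, adding them to \<open>W\<close>
  gains three edges, so by local sparsity this stops early.\<close>

lemma extend_to_independent_boundary:
  fixes E :: "nat set set" and d T :: real
  assumes "finite V" "S \<subseteq> V" "0 < d" "\<And>e. e \<in> E \<Longrightarrow> card e = 2"
    and sparse: "\<And>W. W \<subseteq> V \<Longrightarrow> W \<noteq> {} \<Longrightarrow> card W \<le> T \<Longrightarrow> card (edges_in E W) < (3/2 - d) * card W"
    and T: "card S \<le> T" "3 * card S / (2 * d) + 2 \<le> T"
  shows "\<exists>W. S \<subseteq> W \<and> W \<subseteq> V \<and> card W \<le> T \<and>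
    (\<forall>x\<in>V - W. \<forall>y\<in>V - W. (\<exists>w\<in>W. {x, w} \<in> E) \<longrightarrow> (\<exists>w\<in>W. {y, w} \<in> E) \<longrightarrow> {x, y} \<notin> E)"
proof -
  \<comment> \<open>The last inequality is the invariant of the enlargement: it holds for
    \<open>S\<close>, and two vertices with three edges add 6 to both sides. Together with sparsity
    it gives \<open>2 * d * card W < 3 * card S\<close>; the \<open>+ 2\<close> in the hypothesis on
    \<open>T\<close> leaves room for one more pair. A largest member of \<open>F\<close> replaces
    the iteration.\<close>
  define F where "F = {W. S \<subseteq> W \<and> W \<subseteq> V \<and> card W \<le> T \<and> 3 * card W \<le> 2 * card (edges_in E W) + 3 * card S}"
  have "finite F" using assms(1) by (intro finite_subset[of F "Pow V"]) (auto simp: F_def)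
  moreover have "S \<in> F" using T assms(2) by (simp add: F_def)
  ultimately have "Max (card ` F) \<in> card ` F"
    by (intro Max_in) auto
  then obtain W where W: "W \<in> F" "card W = Max (card ` F)" by auto
  have maxW: "card W' \<le> card W" if "W' \<in> F" for W'
    unfolding W(2) using that \<open>finite F\<close> by (intro Max_ge) auto
  have WF: "S \<subseteq> W" "W \<subseteq> V" "card W \<le> T" "3 * card W \<le> 2 * card (edges_in E W) + 3 * card S"
    using W(1) by (auto simp: F_def)
  have finW: "finite W" using WF(2) assms(1) finite_subset by blast
  have finE: "finite (edges_in E U)" if "finite U" for U :: "nat set"
    using that by (auto simp: edges_in_def intro: rev_finite_subset[of "Pow U"])
  have "{x, y} \<notin> E" if xy: "x \<in> V - W" "y \<in> V - W" and nb: "\<exists>w\<in>W. {x, w} \<in> E" "\<exists>w\<in>W. {y, w} \<in> E" for x y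
  proof
    assume e: "{x, y} \<in> E"
    obtain v w where vw: "v \<in> W" "{x, v} \<in> E" "w \<in> W" "{y, w} \<in> E" using nb by blast
    have neq: "x \<noteq> y" using assms(4)[OF e] by auto
    define W' where "W' = insert x (insert y W)"
    have cardW': "card W' = card W + 2" using xy neq finW by (simp add: W'_def)
    \<comment> \<open>The three edges are distinct even if \<open>v = w\<close>, because
      \<open>x\<close> and \<open>y\<close> are different and lie outside \<open>W\<close>.\<close>
    define X where "X = {{x, y}, {x, v}, {y, w}}"
    have "card X = 3"
    proof -
      have "{x, y} \<noteq> {x, v}" "{x, y} \<noteq> {y, w}" "{x, v} \<noteq> {y, w}"
        using xy vw(1,3) neq by (auto simp: doubleton_eq_iff)
      then show ?thesis by (simp add: X_def)
    qed
    moreover have "X \<inter> edges_in E W = {}"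
      using xy by (auto simp: X_def edges_in_def)
    moreover have "card (X \<union> edges_in E W) \<le> card (edges_in E W')"
      using finW e vw by (intro card_mono finE) (auto simp: X_def W'_def edges_in_def)
    moreover have "finite X" by (simp add: X_def)
    ultimately have e3: "card (edges_in E W) + 3 \<le> card (edges_in E W')"
      using finE[OF finW] by (simp add: card_Un_disjoint)
    have "card (edges_in E W) < (3/2 - d) * card W"
      using vw(1) by (intro sparse WF) auto
    then have "2 * d * card W < 3 * card S"
      using WF(4) by (simp add: algebra_simps)
    then have "real (card W) \<le> 3 * card S / (2 * d)"
      using assms(3) by (simp add: field_simps)
    then have "card W' \<le> T" using cardW' T(2) by simp
    moreover have "3 * card W' \<le> 2 * card (edges_in E W') + 3 * card S"
      using WF(4) e3 cardW' by simp
    ultimately have "W' \<in> F" using WF xy by (auto simp: F_def W'_def)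
    then show False using maxW[of W'] cardW' by simp
  qed
  then show ?thesis using WF(1-3) by (intro exI[of _ W]) blast
qed

lemma (in edge_condition) colorable_repair:
  fixes d T :: real
  assumes "finite V" "S \<subseteq> V" "0 < d" "\<And>e. e \<in> E \<Longrightarrow> card e = 2"
    and sparse: "\<And>W. W \<subseteq> V \<Longrightarrow> W \<noteq> {} \<Longrightarrow> card W \<le> T \<Longrightarrow> card (edges_in E W) < (3/2 - d) * card W"
    and T: "card S \<le> T" "3 * card S / (2 * d) + 2 \<le> T"
    and k: "3 \<le> k" "colorable (V - S) E k"
  shows "colorable V E (k + 1)"
proof -
  obtain W where W: "S \<subseteq> W" "W \<subseteq> V" "card W \<le> T"
    and indep: "\<And>x y. x \<in> V - W \<Longrightarrow> y \<in> V - W \<Longrightarrow> (\<exists>w\<in>W. {x, w} \<in> E) \<Longrightarrow> (\<exists>w\<in>W. {y, w} \<in> E) \<Longrightarrow> {x, y} \<notin> E"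
    using extend_to_independent_boundary[OF assms(1-4) sparse T] by auto
  have finW: "finite W" using W(2) assms(1) finite_subset by blast
  have deg: "2 * card (edges_in E U) < 3 * card U" if "U \<subseteq> W" "U \<noteq> {}" for U
  proof -
    have "card U \<le> card W" using that finW by (simp add: card_mono)
    then have "card (edges_in E U) < (3/2 - d) * card U"
      using sparse[of U] that W by simp
    also have "\<dots> \<le> 3/2 * card U" using assms(3) by (intro mult_right_mono) auto
    finally show ?thesis by linarith
  qed
  obtain f :: "nat \<Rightarrow> nat" where f: "\<forall>i\<in>W. f i < 3" "\<forall>i\<in>W. \<forall>j\<in>W. {i, j} \<in> E \<longrightarrow> f i \<noteq> f j"
    using three_coloring_sparse[OF finW assms(4) deg] by blast
  have W3: "colorable W E k"
    using colorable_three[of W f E] f finW k(1) by (intro colorable_mono[of W E 3 k]) auto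
  define I where "I = {x \<in> V - W. \<exists>w\<in>W. {x, w} \<in> E}"
  \<comment> \<open>Since \<open>S \<subseteq> W\<close>, the set \<open>L\<close> lies in
    \<open>V - S\<close> and keeps the given colouring.\<close>
  define L where "L = V - W - I"
  have L: "colorable L E k"
    using colorable_subset[OF k(2), of L] W(1) assms(1) by (auto simp: L_def)
  have "colorable (L \<union> W) E k"
  proof (rule colorable_disjoint_Un)
    show "{i, j} \<notin> E" if "i \<in> L" "j \<in> W" for i j
      using that by (auto simp: L_def I_def)
  qed (use L W3 finW assms(1) k(1) in \<open>auto simp: L_def\<close>)
  then have "colorable (L \<union> W \<union> I) E (k + 1)"
  proof (rule colorable_add_independent)
    show "{i, j} \<notin> E" if "i \<in> I" "j \<in> I" for i j
      using that by (intro indep) (auto simp: I_def)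
  qed (use finW assms(1) k(1) in \<open>auto simp: L_def I_def\<close>)
  moreover have "L \<union> W \<union> I = V" using W(2) by (auto simp: L_def I_def)
  ultimately show ?thesis by simp
qed

section \<open>Rounding a vector colouring to a cut by random signs\<close>

definition signed_sum :: "'a set \<Rightarrow> 'a set \<Rightarrow> ('a \<Rightarrow> real) \<Rightarrow> real" where
  "signed_sum L A v = (\<Sum>l\<in>L. if l \<in> A then v l else - v l)"

lemma signed_sum_insert:
  assumes "finite L" "a \<notin> L" "A \<subseteq> L"
  shows "signed_sum (insert a L) (insert a A) v = signed_sum L A v + v a"
    "signed_sum (insert a L) A v = signed_sum L A v - v a"
proof -
  have "(\<Sum>l\<in>L. if l \<in> insert a A then v l else - v l) = (\<Sum>l\<in>L. if l \<in> A then v l else - v l)"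
    using assms(2) by (intro sum.cong) auto
  then show "signed_sum (insert a L) (insert a A) v = signed_sum L A v + v a"
    "signed_sum (insert a L) A v = signed_sum L A v - v a"
    using assms by (auto simp: signed_sum_def)
qed

lemma edge_exp_insert_half:
  assumes "finite L" "a \<notin> L"
  shows "edge_exp (insert a L) (1/2) f = edge_exp L (1/2) (\<lambda>A. (f (insert a A) + f A) / 2)"
  unfolding edge_exp_insert[OF assms] edge_exp_cmult[symmetric] edge_exp_add[symmetric]
  by (rule edge_exp_cong) simp

text \<open>Under \<open>edge_exp L (1/2)\<close> the set \<open>A\<close> of plus signs is uniform,
  so cross terms cancel. Projection on random signs thus preserves inner products on average, as a
  Gaussian would, over a finite sample space.\<close>

lemma signed_sum_mult:
  assumes "finite L"
  shows "edge_exp L (1/2) (\<lambda>A. signed_sum L A v * signed_sum L A w) = (\<Sum>l\<in>L. v l * w l)"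
  using assms
proof (induction L)
  case empty
  show ?case by (simp add: signed_sum_def)
next
  case (insert a L)
  have "edge_exp (insert a L) (1/2) (\<lambda>A. signed_sum (insert a L) A v * signed_sum (insert a L) A w)
      = edge_exp L (1/2) (\<lambda>A. signed_sum L A v * signed_sum L A w + v a * w a)"
    unfolding edge_exp_insert_half[OF insert.hyps]
    by (rule edge_exp_cong) (simp add: signed_sum_insert[OF insert.hyps] algebra_simps)
  then show ?case using insert by (simp add: edge_exp_add)
qed

text \<open>Khintchine's inequality with the Gaussian constant 3. Adding a coordinate contributes
  \<open>6 * (v a)\<^sup>2 * s + (v a) ^ 4\<close>, while the right side grows by the same with a 3
  before the last term.\<close>

lemma signed_sum_fourth_moment:
  assumes "finite L"
  shows "edge_exp L (1/2) (\<lambda>A. (signed_sum L A v) ^ 4) \<le> 3 * (\<Sum>l\<in>L. v l * v l)\<^sup>2"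
  using assms
proof (induction L)
  case empty
  show ?case by (simp add: signed_sum_def)
next
  case (insert a L)
  define s where "s = (\<Sum>l\<in>L. v l * v l)"
  have "edge_exp (insert a L) (1/2) (\<lambda>A. (signed_sum (insert a L) A v) ^ 4)
      = edge_exp L (1/2) (\<lambda>A. (signed_sum L A v) ^ 4 +
          ((6 * (v a)\<^sup>2) * (signed_sum L A v * signed_sum L A v) + (v a) ^ 4))"
    unfolding edge_exp_insert_half[OF insert.hyps]
    by (rule edge_exp_cong) (simp add: signed_sum_insert[OF insert.hyps] eval_nat_numeral algebra_simps)
  also have "\<dots> = edge_exp L (1/2) (\<lambda>A. (signed_sum L A v) ^ 4) + (6 * (v a)\<^sup>2 * s + (v a) ^ 4)"
    unfolding edge_exp_add edge_exp_cmult signed_sum_mult[OF insert.hyps(1)] s_def using insert.hyps by simp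
  also have "\<dots> \<le> 3 * s\<^sup>2 + (6 * (v a)\<^sup>2 * s + (v a) ^ 4)"
    using insert.IH by (simp add: s_def)
  also have "\<dots> \<le> 3 * ((v a)\<^sup>2 + s)\<^sup>2"
    using zero_le_power[of "(v a)\<^sup>2" 2] by (simp add: power2_eq_square eval_nat_numeral algebra_simps)
  finally show ?case using insert.hyps by (simp add: s_def power2_eq_square)
qed

text \<open>A single truncation costs at most \<open>t\<^sup>2 / 24\<close>, by
  \<open>0 \<le> (\<bar>t\<bar> - 12)\<^sup>2\<close>; the mixed terms are split by the inequality
  of arithmetic and geometric means. With second moments 1 and fourth moments at most 3 the mean
  error is at most 8/48, half of the 1/3 that a 4-colouring offers.\<close>

lemma clip_product_error:
  fixes x y :: real
  defines "c \<equiv> \<lambda>t::real. max (-6) (min 6 t)"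
  shows "c x * c y \<le> x * y + (x ^ 4 + x\<^sup>2 + y\<^sup>2 + y ^ 4) / 48"
proof -
  have err: "\<bar>t - c t\<bar> \<le> t\<^sup>2 / 24" and bd: "\<bar>c t\<bar> \<le> \<bar>t\<bar>" for t
  proof -
    have "0 \<le> (t - 12)\<^sup>2" "0 \<le> (t + 12)\<^sup>2" by simp_all
    then have sq: "t - 6 \<le> t\<^sup>2 / 24" "- 6 - t \<le> t\<^sup>2 / 24" "0 \<le> t\<^sup>2 / 24"
      by (simp_all add: power2_diff power2_sum)
    consider "\<bar>t\<bar> \<le> 6" | "6 < t" | "t < -6" by linarith
    then show "\<bar>t - c t\<bar> \<le> t\<^sup>2 / 24"
      by cases (use sq in \<open>simp_all add: c_def abs_le_iff\<close>)
    show "\<bar>c t\<bar> \<le> \<bar>t\<bar>" by (auto simp: c_def max_def min_def)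
  qed
  have "\<bar>x * y - c x * c y\<bar> \<le> \<bar>x - c x\<bar> * \<bar>y\<bar> + \<bar>c x\<bar> * \<bar>y - c y\<bar>"
  proof -
    have "x * y - c x * c y = (x - c x) * y + c x * (y - c y)" by (simp add: algebra_simps)
    then show ?thesis by (metis abs_mult abs_triangle_ineq)
  qed
  also have "\<dots> \<le> x\<^sup>2 / 24 * \<bar>y\<bar> + \<bar>x\<bar> * (y\<^sup>2 / 24)"
    by (intro add_mono mult_mono err bd) auto
  also have "\<dots> \<le> (x ^ 4 + x\<^sup>2 + y\<^sup>2 + y ^ 4) / 48"
  proof -
    have "0 \<le> (x\<^sup>2 - \<bar>y\<bar>)\<^sup>2" "0 \<le> (y\<^sup>2 - \<bar>x\<bar>)\<^sup>2" by simp_all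
    then have "2 * (x\<^sup>2 * \<bar>y\<bar>) \<le> x ^ 4 + y\<^sup>2" "2 * (y\<^sup>2 * \<bar>x\<bar>) \<le> y ^ 4 + x\<^sup>2"
      by (simp_all add: power2_diff flip: power_mult)
    then show ?thesis by (simp add: algebra_simps)
  qed
  finally show ?thesis by linarith
qed

text \<open>The sum is affine in each single coordinate, so moving that coordinate to a suitable end
  of \<open>[-1, 1]\<close> does not increase it; the coordinates are treated one after
  another.\<close>

lemma multilinear_round:
  fixes y :: "'a \<Rightarrow> real"
  assumes "finite W" "finite E" "\<And>e. e \<in> E \<Longrightarrow> finite e" "\<And>i. i \<in> W \<Longrightarrow> \<bar>y i\<bar> \<le> 1"
  shows "\<exists>x. (\<forall>i\<in>W. x i = 1 \<or> x i = -1) \<and> (\<forall>i. i \<notin> W \<longrightarrow> x i = y i) \<and>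
    (\<Sum>e\<in>E. \<Prod>i\<in>e. x i) \<le> (\<Sum>e\<in>E. \<Prod>i\<in>e. y i)"
  using assms(1,4)
proof (induction W)
  case empty
  show ?case by auto
next
  case (insert a W)
  obtain x where x: "\<forall>i\<in>W. x i = 1 \<or> x i = -1" "\<forall>i. i \<notin> W \<longrightarrow> x i = y i"
    "(\<Sum>e\<in>E. \<Prod>i\<in>e. x i) \<le> (\<Sum>e\<in>E. \<Prod>i\<in>e. y i)"
    using insert by auto
  define b where "b = (\<Sum>e\<in>{e \<in> E. a \<in> e}. \<Prod>i\<in>e - {a}. x i)"
  define c where "c = (\<Sum>e\<in>{e \<in> E. a \<notin> e}. \<Prod>i\<in>e. x i)"
  have affine: "(\<Sum>e\<in>E. \<Prod>i\<in>e. (x(a := t)) i) = c + t * b" for t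
  proof -
    have "(\<Sum>e\<in>E. \<Prod>i\<in>e. (x(a := t)) i) =
        (\<Sum>e\<in>{e \<in> E. a \<notin> e}. \<Prod>i\<in>e. (x(a := t)) i) + (\<Sum>e\<in>{e \<in> E. a \<in> e}. \<Prod>i\<in>e. (x(a := t)) i)"
      using assms(2) by (subst sum.union_disjoint[symmetric]) (auto intro!: sum.cong)
    moreover have "(\<Sum>e\<in>{e \<in> E. a \<notin> e}. \<Prod>i\<in>e. (x(a := t)) i) = c"
      unfolding c_def by (intro sum.cong prod.cong) auto
    moreover have "(\<Sum>e\<in>{e \<in> E. a \<in> e}. \<Prod>i\<in>e. (x(a := t)) i) = t * b"
      unfolding b_def sum_distrib_left
    proof (intro sum.cong refl)
      fix e assume "e \<in> {e \<in> E. a \<in> e}"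
      then have "(\<Prod>i\<in>e. (x(a := t)) i) = (x(a := t)) a * (\<Prod>i\<in>e - {a}. (x(a := t)) i)"
        using assms(3) by (intro prod.remove) auto
      also have "(\<Prod>i\<in>e - {a}. (x(a := t)) i) = (\<Prod>i\<in>e - {a}. x i)"
        by (intro prod.cong) auto
      finally show "(\<Prod>i\<in>e. (x(a := t)) i) = t * (\<Prod>i\<in>e - {a}. x i)" by simp
    qed
    ultimately show ?thesis by simp
  qed
  define t :: real where "t = (if 0 \<le> b then -1 else 1)"
  have "\<bar>x a\<bar> \<le> 1" using x(2) insert by simp
  then have "t * b \<le> x a * b"
    using mult_right_mono[of "-1" "x a" b] mult_right_mono_neg[of "x a" 1 b] by (auto simp: t_def)
  then have "(\<Sum>e\<in>E. \<Prod>i\<in>e. (x(a := t)) i) \<le> (\<Sum>e\<in>E. \<Prod>i\<in>e. (x(a := x a)) i)"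
    unfolding affine by simp
  then have "(\<Sum>e\<in>E. \<Prod>i\<in>e. (x(a := t)) i) \<le> (\<Sum>e\<in>E. \<Prod>i\<in>e. y i)"
    using x(3) by simp
  then show ?case using x insert.hyps by (intro exI[of _ "x(a := t)"]) (auto simp: t_def)
qed

text \<open>Project the colouring on a random sign vector and truncate at 6. By the fourth moment bound
  the truncation changes each inner product by at most 1/6 on average.\<close>

lemma (in edge_condition) colorable_4_imp_cut:
  assumes "finite V" "\<And>e. e \<in> E \<Longrightarrow> e \<subseteq> V \<and> card e = 2" "colorable V E 4"
  shows "\<exists>P\<subseteq>V. (\<Sum>e\<in>E. (\<Prod>i\<in>e. if i \<in> P then 1 else -1) + 1 / 216) \<le> (0::real)"
proof -
  obtain M where M: "psd_on V M" "\<And>i. i \<in> V \<Longrightarrow> M i i = 1"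
    "\<And>i j. i \<in> V \<Longrightarrow> j \<in> V \<Longrightarrow> i \<noteq> j \<Longrightarrow> {i, j} \<in> E \<Longrightarrow> R (M i j + 1 / 3)"
    using assms(3) unfolding colorable_def by fastforce
  obtain w where w: "\<And>i j. i \<in> V \<Longrightarrow> j \<in> V \<Longrightarrow> M i j = (\<Sum>l\<in>V. w i l * w j l)"
    using psd_on_factor[OF assms(1) M(1)] by blast
  have finE: "finite E"
    using assms by (intro finite_subset[of E "Pow V"]) auto
  define X where "X i A = signed_sum V A (w i)" for i A
  define Y where "Y i A = max (-6) (min 6 (X i A))" for i A
  have mom2: "edge_exp V (1/2) (\<lambda>A. X i A * X j A) = M i j" if "i \<in> V" "j \<in> V" for i j
    unfolding X_def signed_sum_mult[OF assms(1)] using w that by simp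
  have mom4: "edge_exp V (1/2) (\<lambda>A. X i A ^ 4) \<le> 3" if "i \<in> V" for i
    using signed_sum_fourth_moment[OF assms(1), of "w i"] w[OF that that] M(2)[OF that]
    by (simp add: X_def)
  have edge: "edge_exp V (1/2) (\<lambda>A. \<Prod>i\<in>e. Y i A) \<le> - 1 / 6" if eE: "e \<in> E" for e
  proof -
    obtain i j where e: "e = {i, j}" "i \<noteq> j" "i \<in> V" "j \<in> V"
      using assms(2)[OF eE] by (auto simp: card_2_iff)
    have "edge_exp V (1/2) (\<lambda>A. \<Prod>i\<in>e. Y i A)
        \<le> edge_exp V (1/2) (\<lambda>A. X i A * X j A + 1/48 * (X i A ^ 4 + (X i A * X i A + (X j A * X j A + X j A ^ 4))))"
    proof (rule edge_exp_mono)
      fix A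
      show "(\<Prod>i\<in>e. Y i A) \<le> X i A * X j A + 1/48 * (X i A ^ 4 + (X i A * X i A + (X j A * X j A + X j A ^ 4)))"
        using clip_product_error[of "X i A" "X j A"] e by (simp add: Y_def power2_eq_square add.assoc)
    qed auto
    also have "\<dots> \<le> M i j + 1/48 * (3 + (1 + (1 + 3)))"
      unfolding edge_exp_add edge_exp_cmult
      using e mom2[of i j] mom2[of i i] mom2[of j j] mom4[of i] mom4[of j] M(2)[of i] M(2)[of j] by simp
    also have "M i j \<le> - 1 / 3"
      using R_nonpos[OF M(3)[of i j]] e eE by simp
    finally show ?thesis by simp
  qed
  obtain A where A: "(\<Sum>e\<in>E. \<Prod>i\<in>e. Y i A) \<le> edge_exp V (1/2) (\<lambda>A. \<Sum>e\<in>E. \<Prod>i\<in>e. Y i A)"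
    using edge_exp_ge_min[OF assms(1), of "1/2" "\<lambda>A. \<Sum>e\<in>E. \<Prod>i\<in>e. Y i A"] by auto
  also have "\<dots> \<le> (\<Sum>e\<in>E. - 1 / 6)"
    unfolding edge_exp_sum by (intro sum_mono edge)
  finally have sumY: "(\<Sum>e\<in>E. \<Prod>i\<in>e. Y i A) \<le> - real (card E) / 6" by simp
  \<comment> \<open>Rescaling into \<open>[-1, 1]\<close> divides each product of two factors by 36,
    which turns the surplus 1/6 per edge into 1/216.\<close>
  define y where "y i = Y i A / 6" for i
  have "(\<Prod>i\<in>e. y i) = (\<Prod>i\<in>e. Y i A) / 36" if "e \<in> E" for e
    using assms(2)[OF that] by (simp add: y_def prod_dividef)
  then have "(\<Sum>e\<in>E. \<Prod>i\<in>e. y i) = (\<Sum>e\<in>E. \<Prod>i\<in>e. Y i A) / 36"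
    unfolding sum_divide_distrib by (rule sum.cong[OF refl])
  then have sumy: "(\<Sum>e\<in>E. \<Prod>i\<in>e. y i) \<le> - real (card E) / 216" using sumY by simp
  have "\<bar>y i\<bar> \<le> 1" for i by (auto simp: y_def Y_def)
  then obtain x where x: "\<forall>i\<in>V. x i = 1 \<or> x i = -1"
    "(\<Sum>e\<in>E. \<Prod>i\<in>e. x i) \<le> (\<Sum>e\<in>E. \<Prod>i\<in>e. y i)"
    using multilinear_round[OF assms(1) finE, of y] assms(1,2) finite_subset by metis
  define P where "P = {i \<in> V. x i = 1}"
  have "(\<Prod>i\<in>e. if i \<in> P then 1 else -1) = (\<Prod>i\<in>e. x i)" if "e \<in> E" for e
    using assms(2)[OF that] x(1) by (intro prod.cong) (auto simp: P_def)
  then have "(\<Sum>e\<in>E. (\<Prod>i\<in>e. if i \<in> P then 1 else -1) + 1 / 216) = (\<Sum>e\<in>E. \<Prod>i\<in>e. x i) + card E / 216"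
    by (simp add: sum.distrib)
  then show ?thesis using x(2) sumy by (intro exI[of _ P]) (auto simp: P_def)
qed

section \<open>Probability estimates\<close>

lemma exp_le_quadratic:
  fixes z :: real
  assumes "z \<le> 1 / 2"
  shows "exp z \<le> 1 + z + 2 * z\<^sup>2"
proof -
  have "1 - z \<le> exp (- z)"
    using exp_ge_add_one_self[of "- z"] by simp
  then have "exp z \<le> 1 / (1 - z)"
    using assms by (simp add: exp_minus field_simps)
  also have "\<dots> \<le> 1 + z + 2 * z\<^sup>2"
  proof -
    have "0 \<le> z\<^sup>2 * (1 - 2 * z)" using assms by simp
    then have "1 \<le> (1 + z + 2 * z\<^sup>2) * (1 - z)"
      by (simp add: power2_eq_square algebra_simps)
    then show ?thesis using assms by (simp add: pos_divide_le_eq)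
  qed
  finally show ?thesis .
qed

text \<open>Chernoff bound with exponent parameter \<open>\<eta> / 16\<close>, where \<open>\<eta> = 1 / 216\<close>; the lower bound on \<open>n p\<close>
  is \<open>512 / \<eta>\<^sup>2\<close>.\<close>

lemma prob_cut_le:
  assumes p: "0 \<le> p" "p \<le> 1" "23887872 \<le> real n * p" and n: "1728 \<le> n" and P: "P \<subseteq> {1..n}"
  shows "edge_exp (all_pairs n) p (\<lambda>E. of_bool ((\<Sum>e\<in>E. (\<Prod>i\<in>e. if i \<in> P then 1 else -1) + 1 / 216) \<le> (0::real)))
    \<le> exp (- 2 * real n)"
proof -
  define A where "A = all_pairs n"
  define x :: "nat \<Rightarrow> real" where "x i = (if i \<in> P then 1 else -1)" for i
  define z where "z e = - ((\<Prod>i\<in>e. x i) + 1 / 216) / 3456" for e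
  have x1: "\<bar>\<Prod>i\<in>e. x i\<bar> = 1" for e
    by (cases "finite e") (auto simp: x_def abs_prod intro!: prod.neutral)
  have z1: "\<bar>z e\<bar> \<le> 1 / 1728" for e
    using x1[of e] unfolding z_def abs_le_iff abs_if by (auto split: if_splits)
  have "edge_exp A p (\<lambda>E. of_bool ((\<Sum>e\<in>E. (\<Prod>i\<in>e. x i) + 1 / 216) \<le> 0)) \<le> edge_exp A p (\<lambda>E. \<Prod>e\<in>E. exp (z e))"
  proof (rule edge_exp_mono[OF p(1,2)])
    fix E assume "E \<subseteq> A"
    then have fin: "finite E" using finite_subset[of E A] by (simp add: A_def)
    have "(\<Sum>e\<in>E. z e) = - (\<Sum>e\<in>E. (\<Prod>i\<in>e. x i) + 1 / 216) / 3456"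
      by (simp only: z_def sum_divide_distrib[symmetric] sum_negf)
    then have "(\<Prod>e\<in>E. exp (z e)) = exp (- (\<Sum>e\<in>E. (\<Prod>i\<in>e. x i) + 1 / 216) / 3456)"
      using exp_sum[OF fin, of z] by simp
    then show "of_bool ((\<Sum>e\<in>E. (\<Prod>i\<in>e. x i) + 1 / 216) \<le> 0) \<le> (\<Prod>e\<in>E. exp (z e))"
      by auto
  qed
  also have "\<dots> = (\<Prod>e\<in>A. 1 - p + p * exp (z e))"
    by (simp add: edge_exp_prod A_def)
  also have "\<dots> \<le> (\<Prod>e\<in>A. exp (p * (z e + 2 / 1728\<^sup>2)))"
  proof (rule prod_mono, safe)
    fix e
    have "(z e)\<^sup>2 \<le> (1 / 1728)\<^sup>2" using z1[of e] by (simp only: abs_le_square_iff[symmetric])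
    then have "exp (z e) \<le> 1 + z e + 2 / 1728\<^sup>2"
      using exp_le_quadratic[of "z e"] abs_le_D1[OF z1[of e]] by (simp add: power_divide)
    then have "p * exp (z e) \<le> p * (1 + (z e + 2 / 1728\<^sup>2))"
      using p by (intro mult_left_mono) auto
    then have "1 - p + p * exp (z e) \<le> 1 + p * (z e + 2 / 1728\<^sup>2)" by (simp add: algebra_simps)
    also have "\<dots> \<le> exp (p * (z e + 2 / 1728\<^sup>2))" by (rule exp_ge_add_one_self)
    finally show "1 - p + p * exp (z e) \<le> exp (p * (z e + 2 / 1728\<^sup>2))" .
    show "0 \<le> 1 - p + p * exp (z e)" using p by simp
  qed
  also have "\<dots> = exp (p * (\<Sum>e\<in>A. z e + 2 / 1728\<^sup>2))"
    by (simp only: exp_sum[symmetric] A_def finite_all_pairs sum_distrib_left[symmetric])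
  also have "\<dots> \<le> exp (- 2 * real n)"
  proof -
    define m where "m = real n"
    have m: "1728 \<le> m" using n by (simp add: m_def)
    \<comment> \<open>The sum over all pairs cannot drop below \<open>- m / 2\<close>, negligible
      against the surplus of order \<open>m\<^sup>2\<close> that a 4-colouring would need.\<close>
    have "0 \<le> (\<Sum>i\<in>{1..n}. x i)\<^sup>2" by simp
    moreover have "(x i)\<^sup>2 = 1" for i by (simp add: x_def)
    then have "(\<Sum>i\<in>{1..n}. (x i)\<^sup>2) = m" by (simp add: m_def)
    ultimately have chi: "- m / 2 \<le> (\<Sum>e\<in>A. \<Prod>i\<in>e. x i)"
      using sum_all_pairs_prod[of x n] unfolding A_def by linarith
    have card: "real (card A) = (m\<^sup>2 - m) / 2" using card_all_pairs[of n] by (simp add: A_def m_def)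
    have "(\<Sum>e\<in>A. z e + 2 / 1728\<^sup>2) = - (\<Sum>e\<in>A. (\<Prod>i\<in>e. x i)) / 3456 - real (card A) / (216 * 3456) + real (card A) * (2 / 1728\<^sup>2)"
      by (simp add: z_def sum.distrib sum_subtractf sum_negf sum_divide_distrib[symmetric] add_divide_distrib diff_divide_distrib)
    \<comment> \<open>As \<open>1492992 = 2 * 216 * 3456\<close>, the quadratic error of the
      exponential consumes exactly half of the gain per pair.\<close>
    also have "\<dots> \<le> m / 6912 - (m\<^sup>2 - m) / 2 / 1492992"
      using chi unfolding card by (simp add: field_simps)
    also have "\<dots> \<le> - m\<^sup>2 / 11943936"
    proof -
      have "1728 * m \<le> m\<^sup>2" using m by (simp add: power2_eq_square)
      then show ?thesis using m by (simp add: field_simps)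
    qed
    finally have "p * (\<Sum>e\<in>A. z e + 2 / 1728\<^sup>2) \<le> p * (- m\<^sup>2 / 11943936)"
      using p by (intro mult_left_mono) auto
    also have "\<dots> \<le> - 2 * m"
    proof -
      have "23887872 * m \<le> (m * p) * m" using p(3) m by (intro mult_right_mono) (auto simp: m_def)
      then show ?thesis by (simp add: power2_eq_square field_simps)
    qed
    finally show ?thesis by (simp add: m_def)
  qed
  finally show ?thesis by (simp only: A_def x_def)
qed

text \<open>Union bound over all cuts: \<open>exp (- 2 * n)\<close> for each one absorbs their
  number \<open>2 ^ n\<close>, because \<open>2 \<le> exp 1\<close>.\<close>

lemma (in edge_condition) prob_colorable_4:
  assumes p: "0 \<le> p" "p \<le> 1" "23887872 \<le> real n * p" and n: "1728 \<le> n"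
  shows "edge_exp (all_pairs n) p (\<lambda>E. of_bool (colorable {1..n} E 4)) \<le> exp (- real n)"
proof -
  have "edge_exp (all_pairs n) p (\<lambda>E. of_bool (colorable {1..n} E 4))
    \<le> (\<Sum>P\<in>Pow {1..n}. edge_exp (all_pairs n) p
        (\<lambda>E. of_bool ((\<Sum>e\<in>E. (\<Prod>i\<in>e. if i \<in> P then 1 else -1) + 1 / 216) \<le> (0::real))))"
  proof (rule edge_exp_union_bound[OF p(1,2)])
    fix E assume "E \<subseteq> all_pairs n" "colorable {1..n} E 4"
    then show "\<exists>P\<in>Pow {1..n}. (\<Sum>e\<in>E. (\<Prod>i\<in>e. if i \<in> P then 1 else -1) + 1 / 216) \<le> (0::real)"
      using colorable_4_imp_cut[of "{1..n}" E] by (auto simp: all_pairs_eq)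
  qed simp
  also have "\<dots> \<le> (\<Sum>P\<in>Pow {1..n}. exp (- 2 * real n))"
    using prob_cut_le[OF p n] by (intro sum_mono) auto
  also have "\<dots> = 2 ^ n * exp (- 2 * real n)" by (simp add: card_Pow)
  also have "\<dots> \<le> exp 1 ^ n * exp (- 2 * real n)"
    using exp_ge_add_one_self[of 1] by (intro mult_right_mono power_mono) auto
  also have "\<dots> = exp (- real n)"
    by (simp flip: exp_of_nat_mult exp_add)
  finally show ?thesis .
qed

section \<open>Local sparsity of the random graph\<close>

lemma power_self_le_fact: "real k ^ k \<le> 3 ^ k * fact k"
proof (induction k)
  case (Suc k)
  show ?case
  proof (cases "k = 0")
    case False
    have "(1 + 1 / real k) ^ k \<le> exp (1 / real k) ^ k"
      by (intro power_mono exp_ge_add_one_self) auto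
    also have "\<dots> = exp 1" using False by (simp flip: exp_of_nat_mult)
    also have "\<dots> \<le> 3" by (rule exp_le)
    finally have "real k ^ k * (1 + 1 / real k) ^ k \<le> (3 ^ k * fact k) * 3"
      using Suc.IH by (intro mult_mono) auto
    moreover have "real k ^ k * (1 + 1 / real k) ^ k = real (Suc k) ^ k"
      using False by (simp flip: power_mult_distrib add: distrib_left add.commute)
    ultimately have "real (Suc k) ^ k \<le> 3 * 3 ^ k * fact k" by simp
    then have "real (Suc k) * real (Suc k) ^ k \<le> real (Suc k) * (3 * 3 ^ k * fact k)"
      by (intro mult_left_mono) auto
    then show ?thesis by (simp add: algebra_simps)
  qed simp
qed simp

text \<open>The usual estimate with 3 in place of the base of the natural logarithm, obtained from
  the weak Stirling bound \<open>power_self_le_fact\<close>.\<close>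

lemma binomial_le_power:
  assumes "1 \<le> k"
  shows "real (n choose k) \<le> (3 * real n / real k) ^ k"
proof -
  have "real (n choose k) * fact k \<le> real n ^ k"
    using binomial_fact_pow[of n k] by (metis of_nat_fact of_nat_le_iff of_nat_mult of_nat_power)
  then have "3 ^ k * (real (n choose k) * fact k) \<le> 3 ^ k * real n ^ k"
    by (rule mult_left_mono) simp
  moreover have "real (n choose k) * real k ^ k \<le> real (n choose k) * (3 ^ k * fact k)"
    by (intro mult_left_mono power_self_le_fact) simp
  ultimately have "real (n choose k) * real k ^ k \<le> 3 ^ k * real n ^ k"
    by (simp only: mult_ac)
  then show ?thesis
    using assms by (simp add: power_divide power_mult_distrib pos_le_divide_eq)
qed

definition locally_sparse :: "nat \<Rightarrow> nat set set \<Rightarrow> real \<Rightarrow> real \<Rightarrow> bool" where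
  "locally_sparse n E a T \<longleftrightarrow>
     (\<forall>W. W \<subseteq> {1..n} \<longrightarrow> W \<noteq> {} \<longrightarrow> real (card W) \<le> T \<longrightarrow> real (card (edges_in E W)) < a * real (card W))"

text \<open>First moment over pairs of a \<open>t\<close>-set \<open>W\<close> and exactly
  \<open>m\<close> of its pairs, all of which must be present.\<close>

lemma prob_dense_subset:
  assumes p: "0 \<le> p" "p \<le> 1"
  shows "edge_exp (all_pairs n) p (\<lambda>E. of_bool (\<exists>W\<subseteq>{1..n}. card W = t \<and> m \<le> card (edges_in E W)))
    \<le> real (n choose t) * real ((t choose 2) choose m) * p ^ m"
proof -
  define C where "C W = {F. F \<subseteq> {e. e \<subseteq> W \<and> card e = 2} \<and> card F = m}" for W :: "nat set"
  have pairs: "finite {e. e \<subseteq> W \<and> card e = 2}" if "finite W" for W :: "nat set"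
    using that by (auto intro: rev_finite_subset[of "Pow W"])
  have C: "finite (C W) \<and> card (C W) = (t choose 2) choose m" if "W \<subseteq> {1..n}" "card W = t" for W
  proof -
    have W: "finite W" using that finite_subset by blast
    have "finite (C W)"
      using pairs[OF W] by (auto simp: C_def intro: rev_finite_subset[of "Pow {e. e \<subseteq> W \<and> card e = 2}"])
    moreover have "card (C W) = (t choose 2) choose m"
      unfolding C_def using n_subsets[OF pairs[OF W]] n_subsets[OF W] that(2) by simp
    ultimately show ?thesis by blast
  qed
  have "edge_exp (all_pairs n) p (\<lambda>E. of_bool (\<exists>W\<subseteq>{1..n}. card W = t \<and> m \<le> card (edges_in E W)))
    \<le> (\<Sum>W\<in>{W. W \<subseteq> {1..n} \<and> card W = t}. edge_exp (all_pairs n) p (\<lambda>E. of_bool (\<exists>F\<in>C W. F \<subseteq> E)))"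
  proof (rule edge_exp_union_bound[OF p])
    fix E assume E: "E \<subseteq> all_pairs n" "\<exists>W\<subseteq>{1..n}. card W = t \<and> m \<le> card (edges_in E W)"
    then obtain W where W: "W \<subseteq> {1..n}" "card W = t" "m \<le> card (edges_in E W)" by blast
    obtain F where "F \<subseteq> edges_in E W" "card F = m"
      using obtain_subset_with_card_n[OF W(3)] by blast
    note WF = W(1,2) this
    then have "F \<in> C W" "F \<subseteq> E"
      using E(1) by (auto simp: C_def edges_in_def all_pairs_eq)
    then show "\<exists>W\<in>{W. W \<subseteq> {1..n} \<and> card W = t}. \<exists>F\<in>C W. F \<subseteq> E"
      using WF by blast
  qed (auto intro: rev_finite_subset[of "Pow {1..n}"])
  also have "\<dots> \<le> (\<Sum>W\<in>{W. W \<subseteq> {1..n} \<and> card W = t}. real ((t choose 2) choose m) * p ^ m)"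
  proof (rule sum_mono)
    fix W assume "W \<in> {W. W \<subseteq> {1..n} \<and> card W = t}"
    then have W: "W \<subseteq> {1..n}" "card W = t" by auto
    have "edge_exp (all_pairs n) p (\<lambda>E. of_bool (\<exists>F\<in>C W. F \<subseteq> E))
      \<le> (\<Sum>F\<in>C W. edge_exp (all_pairs n) p (\<lambda>E. of_bool (F \<subseteq> E)))"
      using C[OF W] by (intro edge_exp_union_bound p) auto
    also have "\<dots> = (\<Sum>F\<in>C W. p ^ m)"
    proof (rule sum.cong)
      fix F assume "F \<in> C W"
      then have "F \<subseteq> all_pairs n" "card F = m" using W(1) by (auto simp: C_def all_pairs_eq)
      then show "edge_exp (all_pairs n) p (\<lambda>E. of_bool (F \<subseteq> E)) = p ^ m"
        by (simp add: edge_exp_superset)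
    qed simp
    finally show "edge_exp (all_pairs n) p (\<lambda>E. of_bool (\<exists>F\<in>C W. F \<subseteq> E)) \<le> real ((t choose 2) choose m) * p ^ m"
      using C[OF W] by simp
  qed
  also have "\<dots> = real (n choose t) * real ((t choose 2) choose m) * p ^ m"
    using n_subsets[of "{1..n}" t] by simp
  finally show ?thesis .
qed

text \<open>Per vertex, choosing the set costs \<open>3 * n / t\<close> and its edges contribute
  \<open>(2 * t * p) powr a\<close>. The powers of \<open>t\<close> combine to
  \<open>t powr (a - 1)\<close>, which increases in \<open>t\<close> because
  \<open>1 \<le> a\<close>, so one base serves all sizes up to \<open>T\<close>. The 12 is
  \<open>3 * 4\<close>, with \<open>2 powr a \<le> 4\<close>.\<close>

lemma dense_subset_count_le:
  fixes a T p :: real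
  assumes a: "1 \<le> a" "a \<le> 2" and t: "1 \<le> t" "real t \<le> T" and p: "0 < p" "2 * T * p \<le> 1"
    and m: "m = nat \<lceil>a * real t\<rceil>"
  shows "real (n choose t) * real ((t choose 2) choose m) * p ^ m
    \<le> (12 * real n * T powr (a - 1) * p powr a) ^ t"
proof -
  have at: "a * real t \<le> real m" unfolding m by (rule real_nat_ceiling_ge)
  have "real t \<le> a * real t" using a t by simp
  then have tm: "real t \<le> real m" using at by simp
  then have m1: "1 \<le> m" using t by simp
  have "3 * real (t choose 2) / real m \<le> 2 * real t"
  proof -
    have "2 * (t choose 2) \<le> t * t" unfolding choose_two
      by (meson diff_le_self le_trans mult_le_mono2 times_div_less_eq_dividend)
    then have "2 * real (t choose 2) \<le> real t * real t" by (metis of_nat_le_iff of_nat_mult of_nat_numeral)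
    also have "\<dots> \<le> real t * real m" using tm by (intro mult_left_mono) auto
    finally have "2 * real (t choose 2) \<le> real t * real m" .
    moreover have "0 \<le> real t * real m" by simp
    ultimately have "3 * real (t choose 2) \<le> 2 * (real t * real m)" by linarith
    then show ?thesis using m1 by (simp add: pos_divide_le_eq mult_ac)
  qed
  then have "(3 * real (t choose 2) / real m) ^ m \<le> (2 * real t) ^ m" by (intro power_mono) auto
  then have "real ((t choose 2) choose m) * p ^ m \<le> (2 * real t) ^ m * p ^ m"
    using binomial_le_power[OF m1, of "t choose 2"] p by (intro mult_right_mono) auto
  also have "\<dots> = (2 * real t * p) powr real m"
    using t p by (simp add: powr_realpow power_mult_distrib)
  \<comment> \<open>Lowering the exponent from the rounded \<open>m\<close> to \<open>a * t\<close>
    is allowed because the base is at most 1; this is the purpose of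
    \<open>2 * T * p \<le> 1\<close>.\<close>
  also have "\<dots> \<le> (2 * real t * p) powr (a * real t)"
  proof (rule powr_mono'[OF at])
    have "2 * real t * p \<le> 2 * T * p" using t p by (intro mult_right_mono) auto
    then show "2 * real t * p \<le> 1" using p(2) by linarith
  qed (use p in simp)
  also have "\<dots> = ((2 * real t * p) powr a) ^ t"
    using t p by (simp add: powr_powr[symmetric] powr_realpow)
  finally have "real (n choose t) * (real ((t choose 2) choose m) * p ^ m)
      \<le> (3 * real n / real t) ^ t * ((2 * real t * p) powr a) ^ t"
    using binomial_le_power[OF t(1), of n] p by (intro mult_mono) auto
  also have "\<dots> = (3 * real n / real t * (2 * real t * p) powr a) ^ t"
    by (simp only: power_mult_distrib)
  also have "\<dots> \<le> (12 * real n * T powr (a - 1) * p powr a) ^ t"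
  proof (rule power_mono)
    have "3 * real n / real t * (2 * real t * p) powr a = 3 * real n * 2 powr a * (real t powr (a - 1)) * p powr a"
      using t p by (simp add: powr_mult powr_diff)
    also have "\<dots> \<le> 3 * real n * 4 * (T powr (a - 1)) * p powr a"
    proof (intro mult_mono)
      have "2 powr a \<le> (2::real) powr 2" using a by (intro powr_mono) auto
      then show "2 powr a \<le> (4::real)" by simp
      show "real t powr (a - 1) \<le> T powr (a - 1)" using a t by (intro powr_mono2) auto
    qed auto
    finally show "3 * real n / real t * (2 * real t * p) powr a \<le> 12 * real n * T powr (a - 1) * p powr a" by simp
  qed (use p in simp)
  finally show ?thesis by (simp add: mult_ac)
qed

text \<open>A set size \<open>t\<close> fails with probability at most \<open>q ^ t\<close>, and the
  geometric series starts at \<open>t = 1\<close>, so its sum is of the order of its first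
  term.\<close>

lemma prob_not_locally_sparse:
  fixes a T p :: real
  assumes a: "1 \<le> a" "a \<le> 2" and p: "0 < p" "p \<le> 1" "2 * T * p \<le> 1"
    and q: "q = 12 * real n * T powr (a - 1) * p powr a" "q \<le> 1 / 2"
  shows "edge_exp (all_pairs n) p (\<lambda>E. of_bool (\<not> locally_sparse n E a T)) \<le> 2 * q"
proof -
  define I where "I = {t \<in> {1..n}. real t \<le> T}"
  define D where "D t E \<longleftrightarrow> (\<exists>W\<subseteq>{1..n}. card W = t \<and> nat \<lceil>a * real t\<rceil> \<le> card (edges_in E W))" for t E
  have q0: "0 \<le> q" by (simp add: q(1))
  have "edge_exp (all_pairs n) p (\<lambda>E. of_bool (\<not> locally_sparse n E a T))
    \<le> (\<Sum>t\<in>I. edge_exp (all_pairs n) p (\<lambda>E. of_bool (D t E)))"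
  proof (rule edge_exp_union_bound)
    fix E assume "\<not> locally_sparse n E a T"
    then obtain W where W: "W \<subseteq> {1..n}" "W \<noteq> {}" "real (card W) \<le> T" "a * real (card W) \<le> card (edges_in E W)"
      by (auto simp: locally_sparse_def not_less)
    have "finite W" using W(1) finite_subset by blast
    then have "1 \<le> card W" "card W \<le> n"
      using W(1,2) card_mono[of "{1..n}" W] by (auto simp: Suc_le_eq card_gt_0_iff)
    then have "card W \<in> I" using W(3) by (simp add: I_def)
    moreover have "D (card W) E"
      unfolding D_def using W(1,4) by (intro exI[of _ W]) (simp add: nat_le_iff ceiling_le_iff)
    ultimately show "\<exists>t\<in>I. D t E" by blast
  qed (use p in \<open>auto simp: I_def\<close>)
  also have "\<dots> \<le> (\<Sum>t\<in>I. q ^ t)"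
  proof (rule sum_mono)
    fix t assume t: "t \<in> I"
    have "edge_exp (all_pairs n) p (\<lambda>E. of_bool (D t E)) \<le>
        real (n choose t) * real ((t choose 2) choose nat \<lceil>a * real t\<rceil>) * p ^ nat \<lceil>a * real t\<rceil>"
      unfolding D_def using p by (intro prob_dense_subset) auto
    also have "\<dots> \<le> q ^ t"
      unfolding q(1) using t a p by (intro dense_subset_count_le) (auto simp: I_def)
    finally show "edge_exp (all_pairs n) p (\<lambda>E. of_bool (D t E)) \<le> q ^ t" .
  qed
  also have "\<dots> \<le> (\<Sum>t\<in>{1..n}. q ^ t)"
    using q0 by (intro sum_mono2) (auto simp: I_def)
  \<comment> \<open>The sharper form with the factor \<open>1 - (1/2) ^ n\<close> is what the
    induction needs.\<close>
  also have "\<dots> \<le> 2 * q * (1 - (1/2) ^ n)"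
  proof (induction n)
    case (Suc n)
    have "q ^ Suc n = q * q ^ n" by simp
    also have "\<dots> \<le> q * (1/2) ^ n" using q0 q(2) by (intro mult_left_mono power_mono) auto
    finally show ?case using Suc by (simp add: algebra_simps)
  qed simp
  also have "\<dots> \<le> 2 * q" using q0 by (intro mult_left_le) auto
  finally show ?thesis .
qed

section \<open>Concentration\<close>

context edge_condition
begin

definition chromatic :: "nat \<Rightarrow> nat set set \<Rightarrow> real" where
  "chromatic n E = Inf {k. 1 < k \<and> colorable {1..n} E k}"

lemma colorable_large:
  assumes "E \<subseteq> all_pairs n"
  shows "colorable {1..n} E (2 + real n)"
proof -
  have "{i} \<notin> E" for i using assms by (auto simp: all_pairs_eq)
  then show ?thesis using colorable_card[of "{1..n}" E] by simp
qed

text \<open>Monotonicity in \<open>k\<close> replaces attainment of the infimum;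
  \<open>1 \<le> u\<close> ensures that each \<open>k > u\<close> is admissible.\<close>

lemma chromatic_le_iff:
  assumes E: "E \<subseteq> all_pairs n" and u: "1 \<le> u"
  shows "chromatic n E \<le> u \<longleftrightarrow> (\<forall>k>u. colorable {1..n} E k)"
proof
  define C where "C = {k. 1 < k \<and> colorable {1..n} E k}"
  have "2 + real n \<in> C" using colorable_large[OF E] by (simp add: C_def)
  then have ne: "C \<noteq> {}" by blast
  have bdd: "bdd_below C" by (rule bdd_belowI[of _ 1]) (simp add: C_def)
  have chromatic: "chromatic n E = Inf C" by (simp add: chromatic_def C_def)
  show "\<forall>k>u. colorable {1..n} E k" if le: "chromatic n E \<le> u"
  proof (intro allI impI)
    fix k assume "u < k"
    then obtain l where "l \<in> C" "l < k"
      using cInf_lessD[OF ne, of k] le unfolding chromatic by auto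
    then show "colorable {1..n} E k"
      by (intro colorable_mono[of _ E l k]) (auto simp: C_def)
  qed
  show "chromatic n E \<le> u" if "\<forall>k>u. colorable {1..n} E k"
    unfolding chromatic
  proof (rule dense_ge)
    fix k assume "u < k"
    then show "Inf C \<le> k" using that u bdd by (intro cInf_lower) (auto simp: C_def)
  qed
qed

text \<open>A single \<open>S\<close> has to serve every \<open>k > u\<close>. With
  \<open>m = 0\<close> this is the condition that \<open>chromatic_le_iff\<close> equates with a
  value at most \<open>u\<close>; \<open>m = n\<close> always qualifies.\<close>

definition repairable :: "nat \<Rightarrow> nat set set \<Rightarrow> real \<Rightarrow> nat \<Rightarrow> bool" where
  "repairable n E u m \<longleftrightarrow> (\<exists>S\<subseteq>{1..n}. card S = m \<and> (\<forall>k>u. colorable ({1..n} - S) E k))"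

definition defect :: "nat \<Rightarrow> real \<Rightarrow> nat set set \<Rightarrow> nat" where
  "defect n u E = (LEAST m. repairable n E u m)"

lemma repairable_defect: "repairable n E u (defect n u E)"
  unfolding defect_def
proof (rule LeastI)
  show "repairable n E u n"
    unfolding repairable_def by (intro exI[of _ "{1..n}"]) (simp add: colorable_empty)
qed

lemma defect_le: "repairable n E u m \<Longrightarrow> defect n u E \<le> m"
  unfolding defect_def by (rule Least_le)

text \<open>Recolouring after a change of the edges at \<open>m\<close> only requires deleting \<open>m\<close> as well.\<close>

lemma defect_lipschitz:
  assumes "E \<subseteq> all_pairs n" "F \<subseteq> all_pairs n" "m \<in> {1..n}" "E - star m = F - star m"
  shows "\<bar>real (defect n u E) - real (defect n u F)\<bar> \<le> 1"
proof -
  have one: "defect n u F \<le> defect n u E + 1" if EF: "E - star m = F - star m" for E F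
  proof -
    obtain S where S: "S \<subseteq> {1..n}" "card S = defect n u E" "\<forall>k>u. colorable ({1..n} - S) E k"
      using repairable_defect[of n E u] unfolding repairable_def by blast
    define S' where "S' = insert m S"
    have S': "S' \<subseteq> {1..n}" using S(1) assms(3) by (simp add: S'_def)
    have "{i, j} \<in> E \<longleftrightarrow> {i, j} \<in> F" if "i \<in> {1..n} - S'" "j \<in> {1..n} - S'" for i j
    proof -
      have "{i, j} \<notin> star m" using that by (auto simp: S'_def star_def doubleton_eq_iff)
      then show ?thesis using EF by blast
    qed
    then have eq: "colorable ({1..n} - S') E k \<longleftrightarrow> colorable ({1..n} - S') F k" for k
      by (intro colorable_cong) auto
    have "colorable ({1..n} - S') F k" if "u < k" for k
      using colorable_subset[of "{1..n} - S" E k "{1..n} - S'"] S(3) that unfolding eq[symmetric]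
      by (auto simp: S'_def)
    then have "repairable n F u (card S')"
      unfolding repairable_def using S' by blast
    then have "defect n u F \<le> card S'" by (rule defect_le)
    also have "\<dots> \<le> defect n u E + 1"
      using S(2) card_insert_le_m1 by (simp add: S'_def card_insert_if finite_subset[OF S(1)])
    finally show ?thesis .
  qed
  show ?thesis using one[OF assms(4)] one[OF assms(4)[symmetric]] by linarith
qed

text \<open>Chebyshev is used twice, each time with deviation \<open>sqrt (n / \<epsilon>)\<close>
  as the scale. The event of defect 0 lies \<open>\<mu>\<close> below the mean and is too likely
  unless \<open>\<mu> \<le> sqrt (n / \<epsilon>)\<close>; then twice that value is again one such
  deviation above the mean.\<close>

lemma prob_defect_large:
  assumes p: "0 \<le> p" "p \<le> 1" and \<epsilon>: "0 < \<epsilon>" and n: "1 \<le> n"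
    and zero: "\<epsilon> \<le> edge_exp (all_pairs n) p (\<lambda>E. of_bool (\<forall>k>u. colorable {1..n} E k))"
  shows "edge_exp (all_pairs n) p (\<lambda>E. of_bool (2 * sqrt (n / \<epsilon>) \<le> defect n u E)) \<le> \<epsilon>"
proof -
  define Y where "Y E = real (defect n u E)" for E
  define \<mu> where "\<mu> = edge_exp (all_pairs n) p Y"
  have var: "edge_exp (all_pairs n) p (\<lambda>E. (Y E)\<^sup>2) - (edge_exp (all_pairs n) p Y)\<^sup>2 \<le> real n"
  proof -
    have "edge_exp (\<Union>m\<in>{1..n}. star m) p (\<lambda>E. (Y E)\<^sup>2) - (edge_exp (\<Union>m\<in>{1..n}. star m) p Y)\<^sup>2
        \<le> real (card {1..n})"
    proof (rule edge_exp_variance_blocks[OF _ p _ star_disjoint])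
      show "\<bar>Y E - Y F\<bar> \<le> 1"
        if "m \<in> {1..n}" "E \<subseteq> (\<Union>m\<in>{1..n}. star m)" "F \<subseteq> (\<Union>m\<in>{1..n}. star m)"
          "E - star m = F - star m" for m E F
        using that unfolding Y_def all_pairs_star[symmetric] by (intro defect_lipschitz)
    qed simp_all
    then show ?thesis by (simp add: all_pairs_star)
  qed
  have "\<mu> \<le> sqrt (n / \<epsilon>)"
  proof (cases "0 < \<mu>")
    case True
    have "\<mu>\<^sup>2 * edge_exp (all_pairs n) p (\<lambda>E. of_bool (\<forall>k>u. colorable {1..n} E k)) \<le> real n"
    proof (rule edge_exp_chebyshev[OF _ p True var])
      fix E assume "\<forall>k>u. colorable {1..n} E k"
      then have "repairable n E u 0" unfolding repairable_def by (intro exI[of _ "{}"]) simp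
      then have "Y E = 0" using defect_le[of n E u 0] by (simp add: Y_def)
      then show "\<mu> \<le> \<bar>Y E - edge_exp (all_pairs n) p Y\<bar>" by (simp add: \<mu>_def)
    qed simp
    moreover have "\<mu>\<^sup>2 * \<epsilon> \<le> \<mu>\<^sup>2 * edge_exp (all_pairs n) p (\<lambda>E. of_bool (\<forall>k>u. colorable {1..n} E k))"
      using zero by (intro mult_left_mono) auto
    ultimately have "\<mu>\<^sup>2 \<le> n / \<epsilon>" using \<epsilon> by (simp add: pos_le_divide_eq)
    then show ?thesis by (rule real_le_rsqrt)
  next
    case False
    moreover have "0 \<le> sqrt (n / \<epsilon>)" using \<epsilon> by simp
    ultimately show ?thesis by linarith
  qed
  moreover have pos: "0 < sqrt (n / \<epsilon>)" using \<epsilon> n by simp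
  ultimately have "(sqrt (n / \<epsilon>))\<^sup>2 * edge_exp (all_pairs n) p (\<lambda>E. of_bool (2 * sqrt (n / \<epsilon>) \<le> Y E)) \<le> real n"
    using p by (intro edge_exp_chebyshev[OF _ p pos var]) (auto simp: \<mu>_def)
  then have "n * edge_exp (all_pairs n) p (\<lambda>E. of_bool (2 * sqrt (n / \<epsilon>) \<le> Y E)) \<le> n * \<epsilon>"
    using \<epsilon> by (simp add: field_simps)
  then show ?thesis using n by (simp add: Y_def)
qed

lemma concentration_bound:
  assumes p: "0 \<le> p" "p \<le> 1" and \<epsilon>: "0 < \<epsilon>" "\<epsilon> \<le> 1" and n: "1 \<le> n" and d: "0 < d"
    and four: "edge_exp (all_pairs n) p (\<lambda>E. of_bool (colorable {1..n} E 4)) < \<epsilon>"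
    and T: "2 * sqrt (n / \<epsilon>) \<le> T" "3 * (2 * sqrt (n / \<epsilon>)) / (2 * d) + 2 \<le> T"
  shows "\<exists>u. 1 - 2 * \<epsilon> - edge_exp (all_pairs n) p (\<lambda>E. of_bool (\<not> locally_sparse n E (3/2 - d) T))
    \<le> edge_exp (all_pairs n) p (\<lambda>E. of_bool (u \<le> chromatic n E \<and> chromatic n E \<le> u + 1))"
proof -
  define A where "A = all_pairs n"
  have finA: "finite A" by (simp add: A_def)
  define X where "X = chromatic n"
  define G where "G t = edge_exp A p (\<lambda>E. of_bool (X E \<le> t))" for t
  \<comment> \<open>Only attained values are considered, so that a least one exists; the largest
    attained value belongs to \<open>U\<close> because \<open>\<epsilon> \<le> 1\<close>.\<close>
  define U where "U = {t \<in> X ` Pow A. \<epsilon> \<le> G t}"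
  have finX: "finite (X ` Pow A)" using finA by simp
  then have finU: "finite U" by (simp add: U_def)
  have "G (Max (X ` Pow A)) = edge_exp A p (\<lambda>E. 1)"
    unfolding G_def using Max_ge[OF finX] by (intro edge_exp_cong) auto
  then have "Max (X ` Pow A) \<in> U"
    unfolding U_def using \<epsilon> finA Max_in[OF finX] by (simp add: Pow_not_empty)
  then have neU: "U \<noteq> {}" by blast
  define u where "u = Min U"
  have uU: "u \<in> U" unfolding u_def using finU neU by (rule Min_in)
  then have Gu: "\<epsilon> \<le> G u" by (simp add: U_def)
  \<comment> \<open>If \<open>u < 3\<close>, then \<open>X E \<le> u\<close> gives colourability for
    every \<open>k > 3\<close>, in particular for 4, which is less likely than
    \<open>\<epsilon>\<close>.\<close>
  have u3: "3 \<le> u"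
  proof (rule ccontr)
    assume "\<not> 3 \<le> u"
    have "G u \<le> edge_exp A p (\<lambda>E. of_bool (colorable {1..n} E 4))"
      unfolding G_def
    proof (rule edge_exp_mono[OF p])
      fix E assume "E \<subseteq> A"
      then have "colorable {1..n} E 4" if "X E \<le> u"
        using chromatic_le_iff[of E n 3] that \<open>\<not> 3 \<le> u\<close> by (simp add: X_def A_def)
      then show "of_bool (X E \<le> u) \<le> (of_bool (colorable {1..n} E 4) :: real)" by simp
    qed
    then show False using four Gu by (simp add: A_def)
  qed
  \<comment> \<open>The largest attained value below \<open>u\<close> is not in \<open>U\<close> by
    minimality, and \<open>X E < u\<close> means being at most that value.\<close>
  have below: "edge_exp A p (\<lambda>E. of_bool (X E < u)) \<le> \<epsilon>"
  proof (cases "\<exists>E\<subseteq>A. X E < u")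
    case True
    define L where "L = {t \<in> X ` Pow A. t < u}"
    have L: "finite L" "L \<noteq> {}" using finX True by (auto simp: L_def)
    have MaxL: "Max L \<in> L" using L by (rule Max_in)
    have "edge_exp A p (\<lambda>E. of_bool (X E < u)) \<le> G (Max L)"
      unfolding G_def using Max_ge[OF L(1)] by (intro edge_exp_mono p) (auto simp: L_def)
    moreover have "Max L \<notin> U"
      using MaxL Min_le[OF finU, of "Max L"] unfolding L_def u_def by auto
    then have "G (Max L) < \<epsilon>" using MaxL by (auto simp: U_def L_def)
    ultimately show ?thesis by simp
  next
    case False
    then have "edge_exp A p (\<lambda>E. of_bool (X E < u)) = edge_exp A p (\<lambda>E. 0)"
      by (intro edge_exp_cong) auto
    then show ?thesis using finA \<epsilon> by simp
  qed
  have "G u = edge_exp A p (\<lambda>E. of_bool (\<forall>k>u. colorable {1..n} E k))"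
    unfolding G_def using u3 by (intro edge_exp_cong) (simp add: X_def A_def chromatic_le_iff)
  then have defect: "edge_exp A p (\<lambda>E. of_bool (2 * sqrt (n / \<epsilon>) \<le> defect n u E)) \<le> \<epsilon>"
    unfolding A_def using Gu by (intro prob_defect_large p \<epsilon> n) (simp add: A_def)
  define good where "good E \<longleftrightarrow> u \<le> X E \<and> X E \<le> u + 1" for E
  define sparse where "sparse E = locally_sparse n E (3/2 - d) T" for E
  have "edge_exp A p (\<lambda>E. 1) \<le> edge_exp A p (\<lambda>E. of_bool (good E) +
    (of_bool (X E < u) + (of_bool (2 * sqrt (n / \<epsilon>) \<le> defect n u E) + of_bool (\<not> sparse E))))"
  proof (rule edge_exp_mono[OF p])
    fix E assume E: "E \<subseteq> A"
    have "X E \<le> u + 1" if small: "defect n u E < 2 * sqrt (n / \<epsilon>)" and "sparse E"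
    proof -
      obtain S where S: "S \<subseteq> {1..n}" "card S = defect n u E" "\<forall>k>u. colorable ({1..n} - S) E k"
        using repairable_defect[of n E u] unfolding repairable_def by blast
      have cS: "real (card S) \<le> 2 * sqrt (n / \<epsilon>)" using S(2) small by simp
      have "3 * card S / (2 * d) \<le> 3 * (2 * sqrt (n / \<epsilon>)) / (2 * d)"
        using cS d by (intro divide_right_mono) auto
      then have T': "card S \<le> T" "3 * card S / (2 * d) + 2 \<le> T" using cS T by linarith+
      have "colorable {1..n} E k" if "u + 1 < k" for k
      proof -
        have "colorable {1..n} E ((k - 1) + 1)"
        proof (rule colorable_repair[OF _ S(1) d _ _ T'])
          show "card e = 2" if "e \<in> E" for e using that E by (auto simp: A_def all_pairs_eq)
          show "card (edges_in E W) < (3/2 - d) * card W" if "W \<subseteq> {1..n}" "W \<noteq> {}" "card W \<le> T" for W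
            using that \<open>sparse E\<close> unfolding sparse_def locally_sparse_def by blast
        qed (use that u3 S(3) in auto)
        then show ?thesis by simp
      qed
      then show ?thesis using E u3 by (simp add: X_def A_def chromatic_le_iff)
    qed
    then show "1 \<le> of_bool (good E) +
      (of_bool (X E < u) + (of_bool (2 * sqrt (n / \<epsilon>) \<le> defect n u E) + of_bool (\<not> sparse E)) :: real)"
      by (cases "X E < u"; cases "2 * sqrt (n / \<epsilon>) \<le> defect n u E"; cases "sparse E") (auto simp: good_def)
  qed
  then have "1 \<le> edge_exp A p (\<lambda>E. of_bool (good E)) + (\<epsilon> + (\<epsilon> + edge_exp A p (\<lambda>E. of_bool (\<not> sparse E))))"
    unfolding edge_exp_add using finA below defect by simp
  then show ?thesis
    by (intro exI[of _ u]) (simp add: good_def sparse_def A_def X_def)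
qed

end

section \<open>Choice of parameters and passage to the limit\<close>

lemma gnp_prob_cong: "(\<And>E. E \<subseteq> all_pairs n \<Longrightarrow> P E \<longleftrightarrow> Q E) \<Longrightarrow> gnp_prob n p P = gnp_prob n p Q"
  unfolding gnp_prob_eq_edge_exp by (intro edge_exp_cong) simp

lemma conc_width1_cong:
  assumes "conc_width1 c0 \<delta> X" "\<And>n E. E \<subseteq> all_pairs n \<Longrightarrow> X n E = Y n E"
  shows "conc_width1 c0 \<delta> Y"
proof -
  have "gnp_prob n p (\<lambda>E. u \<le> X n E \<and> X n E \<le> u + 1) = gnp_prob n p (\<lambda>E. u \<le> Y n E \<and> Y n E \<le> u + 1)" for n p u
    using assms(2) by (intro gnp_prob_cong) simp
  then show ?thesis using assms(1) by (simp add: conc_width1_def)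
qed

text \<open>Here \<open>\<epsilon> = x powr (- 2 * d)\<close>, so
  \<open>sqrt (x / \<epsilon>)\<close> is \<open>r\<close>, and the density is
  \<open>3/2 - d\<close>. The three errors are \<open>\<epsilon>\<close> for values below
  \<open>u\<close>, \<open>\<epsilon>\<close> for a large defect, and \<open>2 * q\<close> for a
  dense small set.\<close>

lemma (in edge_condition) conc_width1_at:
  fixes d p :: real and n :: nat
  defines "x \<equiv> real n"
  assumes d: "0 < d" "d \<le> 1 / 10" and n: "1728 \<le> n"
    and p: "23887872 / x < p" "p \<le> x powr (- 5 / 6 - d)"
    and small: "12 / d * x powr (- 1 / 3) \<le> 1"
      "12 * (6 / d) powr (1 / 2 - d) * x powr (- 2 * d / 3) \<le> 1 / 2"
  shows "\<exists>u. 1 - 2 * x powr (- 2 * d) - 24 * (6 / d) powr (1 / 2 - d) * x powr (- 2 * d / 3)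
    \<le> gnp_prob n p (\<lambda>E. u \<le> chromatic n E \<and> chromatic n E \<le> u + 1)"
proof -
  define r where "r = x powr (1 / 2 + d)"
  \<comment> \<open>The repaired set may need \<open>3 * r / d + 2\<close> vertices;
    \<open>6 / d * r\<close> covers this because \<open>2 * d \<le> 3 * r\<close>.\<close>
  define T where "T = 6 / d * r"
  define q where "q = 12 * x * T powr (3 / 2 - d - 1) * p powr (3 / 2 - d)"
  have x: "1728 \<le> x" using n by (simp add: x_def)
  have p0: "0 < p" using p(1) x by (meson divide_pos_pos less_trans zero_less_numeral less_le_trans)
  have p1: "p \<le> 1"
  proof -
    have "x powr (- 5 / 6 - d) \<le> x powr 0" using x d by (intro powr_mono) auto
    then show ?thesis using p(2) x by simp
  qed
  have pc: "23887872 \<le> x * p" using p(1) x by (simp add: pos_divide_less_eq mult.commute)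
  have r1: "1 \<le> r"
    using powr_mono[of 0 "1 / 2 + d" x] x d by (simp add: r_def)
  have TP: "2 * T * p \<le> 1"
  proof -
    have "2 * T * p \<le> 2 * T * x powr (- 5 / 6 - d)"
      using p(2) d r1 by (intro mult_left_mono) (auto simp: T_def)
    also have "\<dots> = 12 / d * (x powr (1 / 2 + d) * x powr (- 5 / 6 - d))"
      by (simp add: T_def r_def)
    also have "x powr (1 / 2 + d) * x powr (- 5 / 6 - d) = x powr (- 1 / 3)"
      unfolding powr_add[symmetric] by simp
    finally show ?thesis using small(1) by linarith
  qed
  have q: "q \<le> 12 * (6 / d) powr (1 / 2 - d) * x powr (- 2 * d / 3)"
  proof -
    have "q \<le> 12 * x * T powr (1 / 2 - d) * (x powr (- 5 / 6 - d)) powr (3 / 2 - d)"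
      unfolding q_def using p(2) p0 d x by (intro mult_mono powr_mono2) auto
    also have "T powr (1 / 2 - d) = (6 / d) powr (1 / 2 - d) * x powr ((1 / 2 + d) * (1 / 2 - d))"
      unfolding T_def r_def using d by (simp only: powr_mult powr_powr)
    also have "12 * x * \<dots> * (x powr (- 5 / 6 - d)) powr (3 / 2 - d) = 12 * (6 / d) powr (1 / 2 - d) *
        (x powr 1 * x powr ((1 / 2 + d) * (1 / 2 - d)) * x powr ((- 5 / 6 - d) * (3 / 2 - d)))"
      using x by (simp add: powr_powr)
    \<comment> \<open>The constant parts \<open>1 + 1/4 - 5/4\<close> cancel, which is the role of
      5/6; the terms in \<open>d\<^sup>2\<close> cancel too, and \<open>(5/6 - 3/2) * d\<close>
      remains.\<close>
    also have "x powr 1 * x powr ((1 / 2 + d) * (1 / 2 - d)) * x powr ((- 5 / 6 - d) * (3 / 2 - d)) = x powr (- 2 * d / 3)"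
      unfolding powr_add[symmetric] by (rule arg_cong[of _ _ "\<lambda>y. x powr y"]) (simp add: field_simps)
    finally show ?thesis .
  qed
  have sparse: "edge_exp (all_pairs n) p (\<lambda>E. of_bool (\<not> locally_sparse n E (3/2 - d) T)) \<le> 2 * q"
  proof (rule prob_not_locally_sparse)
    show "q = 12 * real n * T powr (3 / 2 - d - 1) * p powr (3 / 2 - d)" by (simp add: q_def x_def)
    show "q \<le> 1 / 2" using q small(2) by linarith
  qed (use d p0 p1 TP in auto)
  have \<epsilon>: "0 < x powr (- 2 * d)" "x powr (- 2 * d) \<le> 1"
    using x d powr_mono[of "- 2 * d" 0 x] by auto
  have "exp (- x) < x powr (- 2 * d)"
  proof -
    have "x < exp x" using exp_ge_add_one_self[of x] by linarith
    then have "exp (- x) < x powr (- 1)" using x by (simp add: exp_minus powr_minus)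
    also have "\<dots> \<le> x powr (- 2 * d)" using x d by (intro powr_mono) auto
    finally show ?thesis .
  qed
  then have four: "edge_exp (all_pairs n) p (\<lambda>E. of_bool (colorable {1..n} E 4)) < x powr (- 2 * d)"
    using prob_colorable_4[of p n] p0 p1 pc n by (simp add: x_def)
  have sqrt: "sqrt (x / x powr (- 2 * d)) = r"
  proof -
    have "x / x powr (- 2 * d) = x powr (1 + 2 * d)"
      using x by (simp add: powr_add powr_minus divide_inverse)
    also have "\<dots> = r\<^sup>2" by (simp add: r_def power2_eq_square flip: powr_add)
    finally show ?thesis using r1 by simp
  qed
  have "2 * r \<le> T" "3 * (2 * r) / (2 * d) + 2 \<le> T"
  proof -
    show "2 * r \<le> T"
      using d r1 by (simp add: T_def pos_le_divide_eq)
    have "2 * d \<le> 3 * r" using d r1 by linarith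
    then show "3 * (2 * r) / (2 * d) + 2 \<le> T" using d by (simp add: T_def field_simps)
  qed
  then obtain u where "1 - 2 * x powr (- 2 * d) - edge_exp (all_pairs n) p (\<lambda>E. of_bool (\<not> locally_sparse n E (3/2 - d) T))
    \<le> edge_exp (all_pairs n) p (\<lambda>E. of_bool (u \<le> chromatic n E \<and> chromatic n E \<le> u + 1))"
    using concentration_bound[of p "x powr (- 2 * d)" n d T] p0 p1 \<epsilon> n d four sqrt by (auto simp: x_def)
  then show ?thesis using sparse q unfolding gnp_prob_eq_edge_exp by (intro exI[of _ u]) linarith
qed

lemma (in edge_condition) conc_width1_chromatic:
  assumes "23887872 \<le> c0" "0 < \<delta>"
  shows "conc_width1 c0 \<delta> chromatic"
  unfolding conc_width1_def
proof (intro allI impI)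
  fix p :: "nat \<Rightarrow> real"
  assume p: "\<forall>\<^sub>F n in sequentially. c0 / real n < p n \<and> p n \<le> real n powr (- 5 / 6 - \<delta>)"
  \<comment> \<open>Lowering \<open>\<delta>\<close> only weakens the upper bound on
    \<open>p\<close>; the cap keeps \<open>3/2 - d\<close> at least 1 and
    \<open>x powr (- 2 * d)\<close> above \<open>exp (- x)\<close>.\<close>
  define d where "d = min \<delta> (1 / 10)"
  have d: "0 < d" "d \<le> 1 / 10" "d \<le> \<delta>" using assms(2) by (auto simp: d_def)
  define K where "K = (6 / d) powr (1 / 2 - d)"
  define b where "b n = 1 - 2 * real n powr (- 2 * d) - 24 * K * real n powr (- 2 * d / 3)" for n
  define f where "f n u = gnp_prob n (p n) (\<lambda>E. u \<le> chromatic n E \<and> chromatic n E \<le> u + 1)" for n u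
  have lim: "(\<lambda>n. real n powr s) \<longlonglongrightarrow> 0" if "s < 0" for s
    using that by (rule tendsto_neg_powr[OF _ filterlim_real_sequentially])
  have "(\<lambda>n. 12 / d * real n powr (- 1 / 3)) \<longlonglongrightarrow> 12 / d * 0"
    by (intro tendsto_intros lim) simp
  then have ev1: "\<forall>\<^sub>F n in sequentially. 12 / d * real n powr (- 1 / 3) < 1"
    by (rule order_tendstoD) simp
  have "(\<lambda>n. 12 * K * real n powr (- 2 * d / 3)) \<longlonglongrightarrow> 12 * K * 0"
    using d by (intro tendsto_intros lim) simp
  then have ev2: "\<forall>\<^sub>F n in sequentially. 12 * K * real n powr (- 2 * d / 3) < 1 / 2"
    by (rule order_tendstoD) simp
  have ev: "\<forall>\<^sub>F n in sequentially. (\<exists>u. b n \<le> f n u) \<and> (\<forall>u. f n u \<le> 1)"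
    using p ev1 ev2 eventually_ge_at_top[of 1728]
  proof eventually_elim
    case (elim n)
    have "23887872 / real n \<le> c0 / real n" using assms(1) by (intro divide_right_mono) auto
    then have pl: "23887872 / real n < p n" using elim by linarith
    have "real n powr (- 5 / 6 - \<delta>) \<le> real n powr (- 5 / 6 - d)"
      using elim d by (intro powr_mono) auto
    then have pu: "p n \<le> real n powr (- 5 / 6 - d)" using elim by linarith
    have "real n powr (- 5 / 6 - d) \<le> real n powr 0" using elim d by (intro powr_mono) auto
    then have p1: "p n \<le> 1" using pu elim by simp
    have "0 \<le> 23887872 / real n" by simp
    then have p0: "0 \<le> p n" using pl by linarith
    have "f n u \<le> 1" for u
    proof -
      have "f n u \<le> edge_exp (all_pairs n) (p n) (\<lambda>E. 1)"
        unfolding f_def gnp_prob_eq_edge_exp by (intro edge_exp_mono p0 p1) auto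
      then show ?thesis by simp
    qed
    moreover have "\<exists>u. b n \<le> f n u"
      unfolding b_def f_def K_def
      using conc_width1_at[OF d(1,2) _ pl pu] elim unfolding K_def by simp
    ultimately show ?case by blast
  qed
  define u where "u n = (SOME u. b n \<le> f n u)" for n
  have "b \<longlonglongrightarrow> 1 - 2 * 0 - 24 * K * 0"
    unfolding b_def using d by (intro tendsto_intros lim) auto
  then have b1: "b \<longlonglongrightarrow> 1" by simp
  have lower: "\<forall>\<^sub>F n in sequentially. b n \<le> f n (u n)"
    using ev by eventually_elim (auto simp: u_def intro: someI_ex)
  have upper: "\<forall>\<^sub>F n in sequentially. f n (u n) \<le> 1"
    using ev by eventually_elim blast
  have "(\<lambda>n. f n (u n)) \<longlonglongrightarrow> 1"
    by (rule tendsto_sandwich[OF lower upper b1 tendsto_const])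
  then show "\<exists>u. (\<lambda>n. gnp_prob n (p n) (\<lambda>E. u n \<le> chromatic n E \<and> chromatic n E \<le> u n + 1)) \<longlonglongrightarrow> 1"
    unfolding f_def by blast
qed

text \<open>The factorisation over the index set \<open>{1..n}\<close> uses one coordinate per
  vertex, hence exactly the dimension prescribed. As \<open>E\<close> contains no loops, restricting
  the edge condition to \<open>i \<noteq> j\<close> loses nothing.\<close>

lemma (in edge_condition) colorable_iff_vectors:
  assumes "E \<subseteq> all_pairs n"
  shows "colorable {1..n} E k \<longleftrightarrow> (\<exists>v. unit_tuple n v \<and>
    (\<forall>i\<in>{1..n}. \<forall>j\<in>{1..n}. {i, j} \<in> E \<longrightarrow> R (inner_n n (v i) (v j) + 1 / (k - 1))) \<and>
    (\<forall>i\<in>{1..n}. \<forall>j\<in>{1..n}. i \<noteq> j \<and> {i, j} \<notin> E \<longrightarrow> Q (inner_n n (v i) (v j) + 1 / (k - 1))))"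
    (is "_ \<longleftrightarrow> (\<exists>v. ?coloring v)")
proof
  have loop: "{i, j} \<in> E \<Longrightarrow> i \<noteq> j" for i j
    using assms by (auto simp: all_pairs_eq)
  show "colorable {1..n} E k" if ex: "\<exists>v. ?coloring v"
  proof -
    obtain v where v: "?coloring v" using ex by blast
    have "psd_on {1..n} (\<lambda>i j. inner_n n (v i) (v j))"
      unfolding inner_n_def by (rule psd_on_gram)
    then show ?thesis
      unfolding colorable_def using v
      by (intro exI[of _ "\<lambda>i j. inner_n n (v i) (v j)"]) (auto simp: unit_tuple_def)
  qed
  assume "colorable {1..n} E k"
  then obtain M where M: "psd_on {1..n} M" "\<forall>i\<in>{1..n}. M i i = 1"
    "\<forall>i\<in>{1..n}. \<forall>j\<in>{1..n}. i \<noteq> j \<longrightarrow>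
        (if {i, j} \<in> E then R (M i j + 1 / (k - 1)) else Q (M i j + 1 / (k - 1)))"
    unfolding colorable_def by blast
  obtain w where w: "\<forall>i\<in>{1..n}. \<forall>j\<in>{1..n}. M i j = (\<Sum>l\<in>{1..n}. w i l * w j l)"
    using psd_on_factor[OF _ M(1)] by blast
  have gram: "inner_n n (w i) (w j) = M i j" if "i \<in> {1..n}" "j \<in> {1..n}" for i j
    using w that by (simp add: inner_n_def)
  show "\<exists>v. ?coloring v"
  proof (intro exI[of _ w] conjI ballI impI)
    show "unit_tuple n w" using M(2) by (simp add: unit_tuple_def gram)
    show "R (inner_n n (w i) (w j) + 1 / (k - 1))" if "i \<in> {1..n}" "j \<in> {1..n}" "{i, j} \<in> E" for i j
      using M(3) that loop[of i j] by (simp add: gram)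
    show "Q (inner_n n (w i) (w j) + 1 / (k - 1))"
      if "i \<in> {1..n}" "j \<in> {1..n}" "i \<noteq> j \<and> {i, j} \<notin> E" for i j
      using M(3) that by (simp add: gram)
  qed
qed

section \<open>The three vector chromatic numbers as instances\<close>

interpretation vector: edge_condition "\<lambda>x. x \<le> 0" "\<lambda>x. True"
  by unfold_locales (auto simp: mult_nonneg_nonpos)

interpretation strict: edge_condition "\<lambda>x. x = 0" "\<lambda>x. True"
  by unfold_locales auto

interpretation rigid: edge_condition "\<lambda>x. x = 0" "\<lambda>x. 0 \<le> x"
  by unfold_locales auto

lemma neg_reciprocal_shift:
  fixes x a :: real
  shows "x \<le> - 1 / a \<longleftrightarrow> x + 1 / a \<le> 0"
    and "x = - 1 / a \<longleftrightarrow> x + 1 / a = 0"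
    and "- 1 / a \<le> x \<longleftrightarrow> 0 \<le> x + 1 / a"
  unfolding minus_divide_left[symmetric] by linarith+

lemma theta_half_eq: "E \<subseteq> all_pairs n \<Longrightarrow> vector.chromatic n E = theta_half n E"
  unfolding vector.chromatic_def theta_half_def vector_coloring_def neg_reciprocal_shift
  by (simp add: vector.colorable_iff_vectors del: One_nat_def)

lemma theta_eq: "E \<subseteq> all_pairs n \<Longrightarrow> strict.chromatic n E = theta n E"
  unfolding strict.chromatic_def theta_def strict_vector_coloring_def neg_reciprocal_shift
  by (simp add: strict.colorable_iff_vectors del: One_nat_def)

lemma theta_2_eq: "E \<subseteq> all_pairs n \<Longrightarrow> rigid.chromatic n E = theta_2 n E"
  unfolding rigid.chromatic_def theta_2_def rigid_vector_coloring_def neg_reciprocal_shift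
  by (simp add: rigid.colorable_iff_vectors del: One_nat_def)

theorem theorem3:
  "\<exists>C > 0. \<forall>c0 \<ge> C. \<forall>\<delta> > 0.
     conc_width1 c0 \<delta> theta_half \<and> conc_width1 c0 \<delta> theta \<and> conc_width1 c0 \<delta> theta_2"
proof (intro exI[of _ 23887872] conjI allI impI)
  fix c0 \<delta> :: real
  assume c: "23887872 \<le> c0" "0 < \<delta>"
  show "conc_width1 c0 \<delta> theta_half"
    using vector.conc_width1_chromatic[OF c] theta_half_eq by (rule conc_width1_cong)
  show "conc_width1 c0 \<delta> theta"
    using strict.conc_width1_chromatic[OF c] theta_eq by (rule conc_width1_cong)
  show "conc_width1 c0 \<delta> theta_2"
    using rigid.conc_width1_chromatic[OF c] theta_2_eq by (rule conc_width1_cong)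
qed simp

end
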